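(* Let $C\in\mathcal{C}_{ev}$ be an Extreme Value copula and let $\vartheta\in\mathcal{P}_{\mathcal{A}}$ and $A\in\mathcal{A}$ be the corresponding Pickands dependence measure and Pickands dependence function, respectively. Then the following equivalences hold: (i) $\vartheta$ is absolutely continuous on $(0,1)$ if and only if $C$ is absolutely continuous. (ii) $\vartheta$ has a point mass in $(0,1)$ if and only if $C$ has a non-degenerated discrete component. (iii) $\vartheta$ has a non-degenerated singular component if and only if $C$ has a non-degenerated singular component.
   Context: $\mathbb{I}=[0,1]$; $\lambda$ is Lebesgue measure on $\mathbb{I}$. A bivariate copula $C$ is the restriction to $\mathbb{I}^2$ of a bivariate distribution function with uniform marginals on $\mathbb{I}$; $\mu_C$ is its doubly stochastic measure, $\mu_C([0,x]\times[0,y])=C(x,y)$. $C$ is an Extreme Value copula (EVC), $C\in\mathcal{C}_{ev}$, if there is a copula $B$ with $C(x,y)=\lim_{n\to\infty}B^n(x^{1/n},y^{1/n})$ for all $x,y\in\mathbb{I}$. $\mathcal{A}$ is the set of Pickands dependence functions: convex $A:\mathbb{I}\to\mathbb{I}$ with $\max\{1-t,t\}\le A(t)\le1$. $\mathcal{P}_{\mathcal{A}}$ is the set of Pickands dependence measures: Borel probability measures $\vartheta$ on $\mathbb{I}$ with $\int_{\mathbb{I}}x\,d\vartheta(x)=\frac12$. They are in one-to-one-to-one correspondence with EVCs via $A(t)=1-t+2\int_{[0,t]}\vartheta([0,z])\,d\lambda(z)$, $t\in\mathbb{I}$, and $C(x,y)=(xy)^{A(\log(x)/\log(xy))}$, $x,y\in(0,1)$.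 A finite measure is called singular if it has no point masses and is concentrated on a Lebesgue null set; the Lebesgue decomposition of a finite measure on $\mathbb{I}$ is into its absolutely continuous, discrete and singular parts. Let $K_C$ be the Markov kernel of $C$ (regular conditional distribution of $Y$ given $X$ for $(X,Y)\sim C$, so $\mu_C(E\times F)=\int_EK_C(x,F)\,d\lambda(x)$), and decompose $K_C(x,\cdot)=K_C^{abs}(x,\cdot)+K_C^{dis}(x,\cdot)+K_C^{sing}(x,\cdot)$ into absolutely continuous, discrete and singular sub-Markov kernels. For $\ast\in\{abs,dis,sing\}$ the component $\mu_C^{\ast}$ of $C$ is the measure on $\mathbb{I}^2$ with $\mu_C^{\ast}(E\times F)=\int_EK_C^{\ast}(x,F)\,d\lambda(x)$. $C$ is absolutely continuous if $\mu_C^{abs}(\mathbb{I}^2)=1$. A component is non-degenerated if it has strictly positive total mass. "$\vartheta$ is absolutely continuous on $(0,1)$" means the restriction of $\vartheta$ to $(0,1)$ is absolutely continuous with respect to $\lambda$. *)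

theory Defs
  imports "HOL-Probability.Probability"
begin

text \<open>Lebesgue measure on the unit interval. Its sigma-algebra consists of the Borel subsets of
  the unit interval.\<close>

abbreviation unit_leb :: "real measure" where
  "unit_leb \<equiv> restrict_space lborel {0..1}"

text \<open>Copulas are functions of two real arguments of which only the values on the unit square
  are relevant.\<close>

definition copula :: "(real \<Rightarrow> real \<Rightarrow> real) \<Rightarrow> bool" where
  "copula C \<longleftrightarrow> (\<exists>M :: (real \<times> real) measure.
     prob_space M \<and> sets M = sets borel \<and>
     distr M borel fst = uniform_measure lborel {0..1} \<and>
     distr M borel snd = uniform_measure lborel {0..1} \<and>
     (\<forall>x\<in>{0..1}. \<forall>y\<in>{0..1}. C x y = measure M ({..x} \<times> {..y})))"

definition extreme_value_copula :: "(real \<Rightarrow> real \<Rightarrow> real) \<Rightarrow> bool" where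
  "extreme_value_copula C \<longleftrightarrow> copula C \<and>
     (\<exists>B. copula B \<and> (\<forall>x\<in>{0..1}. \<forall>y\<in>{0..1}.
        (\<lambda>n. (B (x powr (1 / real n)) (y powr (1 / real n))) ^ n) \<longlonglongrightarrow> C x y))"

definition copula_measure :: "(real \<Rightarrow> real \<Rightarrow> real) \<Rightarrow> (real \<times> real) measure" where
  "copula_measure C = (THE \<mu>. sets \<mu> = sets (unit_leb \<Otimes>\<^sub>M unit_leb) \<and>
     (\<forall>x\<in>{0..1}. \<forall>y\<in>{0..1}. emeasure \<mu> ({0..x} \<times> {0..y}) = ennreal (C x y)))"

definition pickands_function :: "(real \<Rightarrow> real) \<Rightarrow> bool" where
  "pickands_function A \<longleftrightarrow> convex_on {0..1} A \<and>
     (\<forall>t\<in>{0..1}. max (1 - t) t \<le> A t \<and> A t \<le> 1)"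

definition pickands_measure :: "real measure \<Rightarrow> bool" where
  "pickands_measure \<theta> \<longleftrightarrow> sets \<theta> = sets unit_leb \<and> prob_space \<theta> \<and>
     (\<integral>x. x \<partial>\<theta>) = 1 / 2"

definition pickands_function_of_measure :: "real measure \<Rightarrow> (real \<Rightarrow> real) \<Rightarrow> bool" where
  "pickands_function_of_measure \<theta> A \<longleftrightarrow>
     (\<forall>t\<in>{0..1}. A t = 1 - t + 2 * (LINT z:{0..t}|lborel. measure \<theta> {0..z}))"

definition copula_of_pickands_function ::
    "(real \<Rightarrow> real) \<Rightarrow> (real \<Rightarrow> real \<Rightarrow> real) \<Rightarrow> bool" where
  "copula_of_pickands_function A C \<longleftrightarrow>
     (\<forall>x\<in>{0<..<1}. \<forall>y\<in>{0<..<1}. C x y = (x * y) powr A (ln x / ln (x * y)))"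

definition discrete_measure :: "real measure \<Rightarrow> bool" where
  "discrete_measure M \<longleftrightarrow>
     (\<exists>D\<in>sets M. countable D \<and> emeasure M (space M - D) = 0)"

definition singular_measure :: "real measure \<Rightarrow> bool" where
  "singular_measure M \<longleftrightarrow> (\<forall>x\<in>space M. emeasure M {x} = 0) \<and>
     (\<exists>N\<in>null_sets unit_leb. emeasure M (space M - N) = 0)"

definition lebesgue_decomposition ::
    "real measure \<Rightarrow> real measure \<Rightarrow> real measure \<Rightarrow> real measure \<Rightarrow> bool" where
  "lebesgue_decomposition M Ma Md Ms \<longleftrightarrow>
     sets Ma = sets M \<and> sets Md = sets M \<and> sets Ms = sets M \<and>
     (\<forall>E\<in>sets M. emeasure M E = emeasure Ma E + emeasure Md E + emeasure Ms E) \<and>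
     absolutely_continuous unit_leb Ma \<and> discrete_measure Md \<and> singular_measure Ms"

text \<open>For a finite Borel measure on the unit interval the decomposition exists and is unique.\<close>

definition abs_part :: "real measure \<Rightarrow> real measure" where
  "abs_part M = (THE Ma. \<exists>Md Ms. lebesgue_decomposition M Ma Md Ms)"

definition dis_part :: "real measure \<Rightarrow> real measure" where
  "dis_part M = (THE Md. \<exists>Ma Ms. lebesgue_decomposition M Ma Md Ms)"

definition sing_part :: "real measure \<Rightarrow> real measure" where
  "sing_part M = (THE Ms. \<exists>Ma Md. lebesgue_decomposition M Ma Md Ms)"

definition markov_kernel_of :: "(real \<Rightarrow> real \<Rightarrow> real) \<Rightarrow> (real \<Rightarrow> real measure) \<Rightarrow> bool" where
  "markov_kernel_of C K \<longleftrightarrow> K \<in> unit_leb \<rightarrow>\<^sub>M prob_algebra unit_leb \<and>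
     (\<forall>E\<in>sets unit_leb. \<forall>F\<in>sets unit_leb.
        emeasure (copula_measure C) (E \<times> F) = (\<integral>\<^sup>+x\<in>E. emeasure (K x) F \<partial>unit_leb))"

text \<open>The kernel of a copula is unique up to a Lebesgue null set of first arguments, so the
  components defined from it below do not depend on the version chosen here.\<close>

definition markov_kernel :: "(real \<Rightarrow> real \<Rightarrow> real) \<Rightarrow> real \<Rightarrow> real measure" where
  "markov_kernel C = (SOME K. markov_kernel_of C K)"

text \<open>The argument \<open>P\<close> is one of \<^const>\<open>abs_part\<close>, \<^const>\<open>dis_part\<close> and \<^const>\<open>sing_part\<close>.\<close>

definition copula_component ::
    "(real measure \<Rightarrow> real measure) \<Rightarrow> (real \<Rightarrow> real \<Rightarrow> real) \<Rightarrow> (real \<times> real) measure" where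
  "copula_component P C = (THE \<nu>. sets \<nu> = sets (unit_leb \<Otimes>\<^sub>M unit_leb) \<and>
     (\<forall>E\<in>sets unit_leb. \<forall>F\<in>sets unit_leb.
        emeasure \<nu> (E \<times> F) = (\<integral>\<^sup>+x\<in>E. emeasure (P (markov_kernel C x)) F \<partial>unit_leb)))"

definition absolutely_continuous_copula :: "(real \<Rightarrow> real \<Rightarrow> real) \<Rightarrow> bool" where
  "absolutely_continuous_copula C \<longleftrightarrow>
     emeasure (copula_component abs_part C) ({0..1} \<times> {0..1}) = 1"

end

theory Submission
  imports Defs "HOL-Real_Asymp.Real_Asymp"
begin

text \<open>
  For fixed \<open>x\<close> in the open unit interval substitute \<open>t = ln x / ln (x y)\<close>, a diffeomorphism of the
  open unit interval in \<open>y\<close>. Off the countably many jumps of \<open>\<Theta>(t) = \<theta>([0,t])\<close> the derivative of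
  \<open>A\<close> is \<open>2 \<Theta> - 1\<close>, and the \<open>x\<close>-derivative of \<open>C\<close> is \<open>h(t) G(t)\<close>, where
  \<open>h(t) = x powr (A(t) / t - 1)\<close> is absolutely continuous in \<open>t\<close> and
  \<open>G(t) = A(t) + (1 - t) (2 \<Theta>(t) - 1)\<close> is the distribution function of \<open>2 (1 - s) d\<theta>(s)\<close>. Thus
  \<open>h G\<close> is, in the coordinate \<open>t\<close>, the distribution function of the Markov kernel of \<open>C\<close> at \<open>x\<close>, and
  by the product rule this kernel is \<open>2 (1 - s) h(s) d\<theta>(s) + h'(s) G(s) ds\<close>. The second
  summand is absolutely continuous and the density of the first one with respect to \<open>\<theta>\<close> is positive,
  so discrete and singular parts of the kernel are those of \<open>\<theta>\<close> inside the open interval.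
\<close>

section \<open>The fundamental theorem of calculus off a countable set\<close>

text \<open>\<Theta> may jump on a dense set, so \<open>A\<close> and \<open>C\<close> need not be
  differentiable everywhere. Differentiability almost everywhere alone does not recover a function
  from its derivative; continuity with a countable exceptional set does. This is used twice: for
  \<open>h\<close> in the angle, and for \<open>C\<close> in its first argument at fixed
  \<open>y\<close>, where countably many angles belong to countably many \<open>x\<close>. The
  kernel is not extracted from the copula: a candidate \<open>K\<close> is written down, its
  integrals are compared with \<open>C\<close> on rectangles anchored at the origin, and almost sure
  uniqueness identifies it with the chosen version. The density \<open>2 * (1 - s) * h x s\<close>
  vanishes at 0 through \<open>h\<close> and at 1 through \<open>1 - s\<close>, so atoms of \<theta>
  at the end points leave no trace; a singular part has no atoms to lose there. The carriers of the
  discrete and the singular part of \<theta> are chosen once, in the angle. Their preimages in the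
  square have the right sections for all interior \<open>x\<close> at once, which makes the
  components measurable in \<open>x\<close>; the change between \<open>y\<close> and the angle
  preserves null sets both ways.\<close>

text \<open>Tilt \<open>g\<close> to \<open>k\<close> with slope \<open>- e\<close> wherever \<open>g\<close> has derivative \<open>0\<close>. A level \<open>c\<close> between the end
  values of \<open>k\<close> can be chosen outside the countable set \<open>k ` S\<close>, and at the last point where
  \<open>k = c\<close> the derivative cannot be negative.\<close>

lemma continuous_zero_derivative_off_countable_le:
  fixes g :: "real \<Rightarrow> real"
  assumes "a \<le> b" and cont: "continuous_on {a..b} g" and S: "countable S"
    and deriv: "\<And>x. x \<in> {a<..<b} - S \<Longrightarrow> (g has_real_derivative 0) (at x)"
  shows "g b \<le> g a"
proof (rule ccontr)
  assume "\<not> g b \<le> g a"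
  then have lt: "g a < g b" and ab: "a < b"
    using \<open>a \<le> b\<close> by (auto simp: less_le)
  \<comment> \<open>Half the mean slope of \<open>g\<close>: the tilted function still rises by half
    of \<open>g b - g a\<close>.\<close>
  define e where "e = (g b - g a) / (2 * (b - a))"
  have e: "e > 0"
    using lt ab by (simp add: e_def)
  define k where "k x = g x - e * (x - a)" for x
  have "k b = g b - (g b - g a) / 2"
    using ab by (simp add: k_def e_def field_simps)
  then have kab: "k a < k b"
    using lt by (simp add: k_def field_simps)
  have contk: "continuous_on {a..b} k"
    unfolding k_def
    by (intro continuous_on_diff cont continuous_on_mult continuous_on_const continuous_on_id)
  have "\<not> {k a<..<k b} \<subseteq> k ` S"
    using uncountable_open_interval[of "k a" "k b"] kab
      countable_subset[OF _ countable_image[OF S, of k], of "{k a<..<k b}"] by auto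
  then obtain c where c: "k a < c" "c < k b" "c \<notin> k ` S"
    by (meson greaterThanLessThan_iff subsetI)
  define Z where "Z = {x \<in> {a..b}. k x \<le> c}"
  have "closed Z"
    unfolding Z_def using continuous_closed_preimage[OF contk, of "{..c}"]
    by (auto simp: vimage_def Int_def)
  moreover have "a \<in> Z" "bdd_above Z"
    using c ab by (auto simp: Z_def bdd_above_def)
  ultimately have Sup: "Sup Z \<in> Z"
    using closed_contains_Sup by blast
  define x where "x = Sup Z"
  have x: "a \<le> x" "x \<le> b" "k x \<le> c"
    using Sup by (auto simp: x_def Z_def)
  have above: "c < k y" if "x < y" "y \<le> b" for y
  proof (rule ccontr)
    assume "\<not> c < k y"
    then have "y \<in> Z"
      using that x by (auto simp: Z_def)
    then show False
      using cSup_upper[of y Z] \<open>bdd_above Z\<close> that by (auto simp: x_def)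
  qed
  have "x < b"
    using x c by (cases "x = b") auto
  have "k x = c"
  proof (rule ccontr)
    assume "k x \<noteq> c"
    then have "k x < c"
      using x by simp
    moreover have "continuous_on {x..b} k"
      by (rule continuous_on_subset[OF contk]) (use x in auto)
    ultimately obtain y where "x \<le> y" "y \<le> b" "k y = c"
      using IVT'[of k x c b] c x by auto
    then show False
      using above[of y] \<open>k x < c\<close> by (cases "x = y") auto
  qed
  then have "a < x" "x \<notin> S"
    using x c by (cases "a = x"; auto)+
  then have "(g has_real_derivative 0) (at x)"
    using deriv \<open>x < b\<close> by auto
  then have "(k has_real_derivative - e) (at x)"
    unfolding k_def by (auto intro!: derivative_eq_intros)
  then obtain d where d: "d > 0" "\<And>h. 0 < h \<Longrightarrow> h < d \<Longrightarrow> k (x + h) < k x"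
    using DERIV_neg_dec_right[of k "- e" x] e by auto
  have "k (x + min (d/2) (b - x)) < k x"
    by (rule d(2)) (use d \<open>x < b\<close> in auto)
  moreover have "c < k (x + min (d/2) (b - x))"
    by (rule above) (use d \<open>x < b\<close> in auto)
  ultimately show False
    using \<open>k x = c\<close> by simp
qed

lemma continuous_zero_derivative_off_countable:
  fixes g :: "real \<Rightarrow> real"
  assumes "a \<le> b" and "continuous_on {a..b} g" and "countable S"
    and "\<And>x. x \<in> {a<..<b} - S \<Longrightarrow> (g has_real_derivative 0) (at x)"
  shows "g b = g a"
proof (rule antisym)
  show "g b \<le> g a"
    by (rule continuous_zero_derivative_off_countable_le) fact+
  have "continuous_on {a..b} (\<lambda>x. - g x)"
    by (intro continuous_intros assms)
  moreover have "((\<lambda>x. - g x) has_real_derivative 0) (at x)" if "x \<in> {a<..<b} - S" for x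
    using DERIV_minus[OF assms(4)[OF that]] by simp
  ultimately have "- g b \<le> - g a"
    using continuous_zero_derivative_off_countable_le[of a b "\<lambda>x. - g x" S] assms by blast
  then show "g a \<le> g b"
    by simp
qed

text \<open>The difference of \<open>F\<close> and the indefinite integral of \<open>f\<close> has
  derivative 0 off \<open>S\<close>. Continuity of \<open>f\<close> off \<open>S\<close> is what
  differentiates the integral there; integrability alone gives this only almost everywhere.\<close>

lemma fundamental_theorem_of_calculus_off_countable:
  fixes F f :: "real \<Rightarrow> real"
  assumes "a \<le> b" and cont: "continuous_on {a..b} F" and S: "countable S"
    and int: "f integrable_on {a..b}"
    and deriv: "\<And>x. x \<in> {a<..<b} - S \<Longrightarrow> (F has_real_derivative f x) (at x)"
    and contf: "\<And>x. x \<in> {a<..<b} - S \<Longrightarrow> isCont f x"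
  shows "(f has_integral (F b - F a)) {a..b}"
proof -
  define g where "g x = F x - integral {a..x} f" for x
  have "g b = g a"
  proof (rule continuous_zero_derivative_off_countable[OF \<open>a \<le> b\<close> _ S])
    show "continuous_on {a..b} g"
      unfolding g_def by (intro continuous_intros cont indefinite_integral_continuous_1 int)
    fix x assume x: "x \<in> {a<..<b} - S"
    have "((\<lambda>u. integral {a..u} f) has_vector_derivative f x) (at x within {a..b} - {})"
      using x contf[OF x]
      by (intro integral_has_vector_derivative_continuous_at int) (auto intro: continuous_at_imp_continuous_within)
    moreover have "at x within {a..b} = at x"
      using x by (intro at_within_interior) auto
    ultimately have "((\<lambda>u. integral {a..u} f) has_real_derivative f x) (at x)"
      by (simp add: has_real_derivative_iff_has_vector_derivative)
    from DERIV_diff[OF deriv[OF x] this] show "(g has_real_derivative 0) (at x)"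
      unfolding g_def by simp
  qed
  then have "integral {a..b} f = F b - F a"
    using \<open>a \<le> b\<close> by (simp add: g_def)
  then show ?thesis
    using int by (simp add: has_integral_iff)
qed

text \<open>\<open>f\<close> may blow up at both end points, so it is integrated first over compact
  subintervals. These exhaust the open interval; the increasing masses converge, and so do the
  increments of \<open>F\<close>, which is continuous up to the ends.\<close>

lemma nn_integral_FTC_off_countable:
  fixes F f :: "real \<Rightarrow> real"
  assumes "a < b" and cont: "continuous_on {a..b} F" and S: "countable S"
    and [measurable]: "f \<in> borel_measurable borel"
    and nonneg: "\<And>x. x \<in> {a<..<b} \<Longrightarrow> 0 \<le> f x"
    and bound: "\<And>c d. a < c \<Longrightarrow> d < b \<Longrightarrow> \<exists>B. \<forall>x\<in>{c..d}. f x \<le> B"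
    and deriv: "\<And>x. x \<in> {a<..<b} - S \<Longrightarrow> (F has_real_derivative f x) (at x)"
    and contf: "\<And>x. x \<in> {a<..<b} - S \<Longrightarrow> isCont f x"
  shows "(\<integral>\<^sup>+x\<in>{a<..<b}. ennreal (f x) \<partial>lborel) = ennreal (F b - F a)"
proof -
  have compact_case: "(\<integral>\<^sup>+x\<in>{c..d}. ennreal (f x) \<partial>lborel) = ennreal (F d - F c)"
    if cd: "a < c" "c \<le> d" "d < b" for c d
  proof -
    obtain B where B: "\<And>x. x \<in> {c..d} \<Longrightarrow> f x \<le> B"
      using bound[of c d] cd by meson
    have sub: "{c..d} \<subseteq> {a<..<b}"
      using cd by auto
    have "set_integrable lborel {c..d} f"
      unfolding set_integrable_def
    proof (rule Bochner_Integration.integrable_bound)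
      show "integrable lborel (\<lambda>x. indicator {c..d} x * \<bar>B\<bar>)"
        by (intro integrable_mult_left integrable_real_indicator) (simp_all add: emeasure_lborel_Icc_eq)
      show "AE x in lborel. norm (indicator {c..d} x *\<^sub>R f x) \<le> norm (indicator {c..d} x * \<bar>B\<bar>)"
      proof (intro AE_I2)
        fix x
        have "norm (f x) \<le> \<bar>B\<bar>" if "x \<in> {c..d}"
          using B[OF that] nonneg[of x] sub that by (auto simp: subset_eq)
        then show "norm (indicator {c..d} x *\<^sub>R f x) \<le> norm (indicator {c..d} x * \<bar>B\<bar>)"
          by (simp add: indicator_def)
      qed
    qed simp
    then have int: "f integrable_on {c..d}"
      using set_borel_integral_eq_integral(1) by blast
    have "continuous_on {c..d} F"
      by (rule continuous_on_subset[OF cont]) (use cd in auto)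
    then have "(f has_integral (F d - F c)) {c..d}"
      by (rule fundamental_theorem_of_calculus_off_countable[OF cd(2) _ S int])
         (use cd deriv contf in auto)
    moreover have "0 \<le> f x" if "x \<in> {c..d}" for x
      using nonneg sub that by blast
    ultimately show ?thesis
      using nn_integral_has_integral_lebesgue'[of "{c..d}" f "F d - F c"] by auto
  qed
  \<comment> \<open>The summand 2 keeps each margin at most half of \<open>b - a\<close>, so already
    the first interval is nonempty.\<close>
  define c where "c n = a + (b - a) / (real n + 2)" for n
  define d where "d n = b - (b - a) / (real n + 2)" for n
  have mid: "a + q \<le> b - q" if "q \<le> (b - a) / 2" for q
    using that by simp
  have cd: "a < c n" "c n \<le> d n" "d n < b" for n
  proof -
    show "a < c n" "d n < b"
      using \<open>a < b\<close> by (auto simp: c_def d_def)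
    have "(b - a) / (real n + 2) \<le> (b - a) / 2"
      using \<open>a < b\<close> by (intro divide_left_mono) auto
    then show "c n \<le> d n"
      unfolding c_def d_def
      using mid by blast
  qed
  have cd_in: "c n \<in> {a..b}" "d n \<in> {a..b}" for n
    using cd[of n] by auto
  have "(\<lambda>n. 1 / (real n + 2)) \<longlonglongrightarrow> 0"
    by real_asymp
  then have lim: "(\<lambda>n. (b - a) / (real n + 2)) \<longlonglongrightarrow> 0"
    using tendsto_mult_right_zero[of "\<lambda>n. 1 / (real n + 2)" sequentially "b - a"] by simp
  have clim: "c \<longlonglongrightarrow> a"
    unfolding c_def using tendsto_add[OF tendsto_const lim, of a] by simp
  have dlim: "d \<longlonglongrightarrow> b"
    unfolding d_def using tendsto_diff[OF tendsto_const lim, of b] by simp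
  let ?N = "density lborel (\<lambda>x. ennreal (f x))"
  have dec: "(b - a) / (real n + 2) \<le> (b - a) / (real m + 2)" if "m \<le> n" for m n
    using that \<open>a < b\<close> by (intro divide_left_mono) auto
  have "(\<lambda>n. emeasure ?N {c n..d n}) \<longlonglongrightarrow> emeasure ?N (\<Union>n. {c n..d n})"
  proof (rule Lim_emeasure_incseq)
    show "incseq (\<lambda>n. {c n..d n})"
    proof (intro monoI)
      fix m n :: nat assume "m \<le> n"
      from dec[OF this] show "{c m..d m} \<subseteq> {c n..d n}"
        by (auto simp: c_def d_def)
    qed
  qed auto
  also have "(\<Union>n. {c n..d n}) = {a<..<b}"
  proof (intro equalityI subsetI)
    fix x assume x: "x \<in> {a<..<b}"
    have "\<forall>\<^sub>F n in sequentially. c n < x" "\<forall>\<^sub>F n in sequentially. x < d n"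
      using x by (auto intro: order_tendstoD[OF clim] order_tendstoD[OF dlim])
    then have "\<forall>\<^sub>F n in sequentially. x \<in> {c n..d n}"
      by eventually_elim auto
    then show "x \<in> (\<Union>n. {c n..d n})"
      by (auto dest: eventually_happens)
  next
    fix x assume "x \<in> (\<Union>n. {c n..d n})"
    then obtain n where "c n \<le> x" "x \<le> d n"
      by auto
    then show "x \<in> {a<..<b}"
      using cd[of n] by auto
  qed
  also have "(\<lambda>n. emeasure ?N {c n..d n}) = (\<lambda>n. ennreal (F (d n) - F (c n)))"
    using compact_case[OF cd] by (simp add: emeasure_density)
  finally have 1: "(\<lambda>n. ennreal (F (d n) - F (c n))) \<longlonglongrightarrow> emeasure ?N {a<..<b}" .
  have "(\<lambda>n. F (d n)) \<longlonglongrightarrow> F b"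
    by (rule continuous_on_tendsto_compose[OF cont dlim])
       (use cd_in \<open>a < b\<close> in \<open>simp_all add: always_eventually\<close>)
  moreover have "(\<lambda>n. F (c n)) \<longlonglongrightarrow> F a"
    by (rule continuous_on_tendsto_compose[OF cont clim])
       (use cd_in \<open>a < b\<close> in \<open>simp_all add: always_eventually\<close>)
  ultimately have "(\<lambda>n. ennreal (F (d n) - F (c n))) \<longlonglongrightarrow> ennreal (F b - F a)"
    by (intro tendsto_ennrealI tendsto_diff)
  from LIMSEQ_unique[OF 1 this] show ?thesis
    by (simp add: emeasure_density)
qed

section \<open>Copula measures, Markov kernels and components\<close>

lemma space_unit_leb: "space unit_leb = {0..1}"
  by (simp add: space_restrict_space)

lemma sets_unit_leb_iff: "E \<in> sets unit_leb \<longleftrightarrow> E \<subseteq> {0..1} \<and> E \<in> sets borel"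
  by (subst sets_restrict_space_iff) auto

lemma null_sets_unit_leb_iff: "N \<in> null_sets unit_leb \<longleftrightarrow> N \<subseteq> {0..1} \<and> N \<in> null_sets lborel"
  by (rule null_sets_restrict_space) simp

lemma prob_space_unit_leb: "prob_space unit_leb"
  by (rule prob_spaceI) (simp add: space_unit_leb emeasure_restrict_space)

section \<open>Generators of the \<sigma>-algebras on the interval and the square\<close>

definition rat_intervals :: "real set set" where
  "rat_intervals = (\<lambda>q. {0..q}) ` (\<rat> \<inter> {0..1})"

lemma countable_rat_intervals: "countable rat_intervals"
  by (simp add: rat_intervals_def countable_rat)

lemma Int_stable_rat_intervals: "Int_stable rat_intervals"
proof (rule Int_stableI)
  fix a b assume "a \<in> rat_intervals" "b \<in> rat_intervals"
  then obtain p q where "a = {0..p}" "b = {0..q}" "p \<in> \<rat> \<inter> {0..1}" "q \<in> \<rat> \<inter> {0..1}"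
    by (auto simp: rat_intervals_def)
  then have "a \<inter> b = {0..min p q}" "min p q \<in> \<rat> \<inter> {0..1}"
    by (auto simp: min_def)
  then show "a \<inter> b \<in> rat_intervals"
    unfolding rat_intervals_def by blast
qed

lemma unit_interval_in_rat_intervals: "{0..1} \<in> rat_intervals"
  unfolding rat_intervals_def by (rule image_eqI[of _ _ 1]) auto

lemma rat_intervals_subset: "rat_intervals \<subseteq> Pow {0..1}"
  by (auto simp: rat_intervals_def)

lemma rat_intervals_sets: "rat_intervals \<subseteq> sets unit_leb"
  by (auto simp: rat_intervals_def sets_unit_leb_iff)

text \<open>For \<open>0 \<le> a < 1\<close> the points of the unit interval up to \<open>a\<close>
  are the intersection of all \<open>{0..q}\<close> with rational \<open>q\<close> between
  \<open>a\<close> and 1. Hence the identity is Borel measurable for the generated \<sigma>-algebra,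
  and every Borel subset of the interval is its own preimage.\<close>

lemma sets_unit_leb_eq: "sets unit_leb = sigma_sets {0..1} rat_intervals"
proof (rule antisym)
  show "sigma_sets {0..1} rat_intervals \<subseteq> sets unit_leb"
    using sets.sigma_sets_subset[OF rat_intervals_sets] by (simp add: space_unit_leb)
  define S where "S = sigma {0..1::real} rat_intervals"
  have [simp]: "space S = {0..1}" "sets S = sigma_sets {0..1} rat_intervals"
    using rat_intervals_subset by (auto simp: S_def)
  have "(\<lambda>w. w) \<in> borel_measurable S"
    unfolding borel_measurable_iff_le
  proof
    fix a :: real
    have top: "{0..1} \<in> sets S"
      using unit_interval_in_rat_intervals by auto
    consider "a < 0" | "a \<ge> 1" | "0 \<le> a" "a < 1"
      by linarith
    then show "{w \<in> space S. w \<le> a} \<in> sets S"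
    proof cases
      case 1
      then have "{w \<in> space S. w \<le> a} = {}"
        by auto
      then show ?thesis
        by (metis sets.empty_sets)
    next
      case 2
      then have "{w \<in> space S. w \<le> a} = {0..1}"
        by auto
      then show ?thesis
        using top by metis
    next
      case 3
      let ?Q = "\<rat> \<inter> {a<..<1}"
      have "{w \<in> space S. w \<le> a} = (\<Inter>q\<in>?Q. {0..q})"
      proof (intro equalityI subsetI)
        fix w assume w: "w \<in> (\<Inter>q\<in>?Q. {0..q})"
        obtain q0 where q0: "q0 \<in> ?Q"
          using Rats_dense_in_real[OF 3(2)] by auto
        have "w \<le> a"
        proof (rule ccontr)
          assume "\<not> w \<le> a"
          \<comment> \<open>Below 1 as well as below \<open>w\<close>, so that \<open>q\<close> is
            an index in \<open>?Q\<close>.\<close>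
          then obtain q where "q \<in> \<rat>" "a < q" "q < min w 1"
            using Rats_dense_in_real[of a "min w 1"] 3 by auto
          then have "q \<in> ?Q" "q < w"
            using 3 by auto
          with INT_D[OF w, of q] show False
            by simp
        qed
        then show "w \<in> {w \<in> space S. w \<le> a}"
          using w q0 by force
      qed (use 3 in auto)
      moreover have "(\<Inter>q\<in>?Q. {0..q}) \<in> sets S"
      proof (rule sets.countable_INT')
        show "countable ?Q"
          by (simp add: countable_rat)
        show "?Q \<noteq> {}"
          using Rats_dense_in_real[OF 3(2)] by auto
        have "{0..q} \<in> rat_intervals" if "q \<in> ?Q" for q
          unfolding rat_intervals_def using that 3 by auto
        then show "(\<lambda>q. {0..q}) ` ?Q \<subseteq> sets S"
          by auto
      qed
      ultimately show ?thesis
        by metis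
    qed
  qed
  note meas = this
  show "sets unit_leb \<subseteq> sigma_sets {0..1} rat_intervals"
  proof
    fix E assume "E \<in> sets unit_leb"
    then have E: "E \<subseteq> {0..1}" "E \<in> sets borel"
      by (auto simp: sets_unit_leb_iff)
    then have "(\<lambda>w. w) -` E \<inter> space S \<in> sets S"
      using measurable_sets[OF meas] by blast
    moreover have "(\<lambda>w. w) -` E \<inter> space S = E"
      using E by auto
    ultimately show "E \<in> sigma_sets {0..1} rat_intervals"
      by simp
  qed
qed

lemma measure_eqI_unit_leb:
  assumes sets: "sets M = sets unit_leb" "sets N = sets unit_leb"
    and fin: "emeasure M {0..1} \<noteq> \<infinity>"
    and eq: "\<And>q. q \<in> \<rat> \<Longrightarrow> 0 \<le> q \<Longrightarrow> q \<le> 1 \<Longrightarrow> emeasure M {0..q} = emeasure N {0..q}"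
  shows "M = N"
  by (rule measure_eqI_generator_eq[where A = "\<lambda>_. {0..1}", OF Int_stable_rat_intervals rat_intervals_subset])
     (use fin eq unit_interval_in_rat_intervals in
        \<open>auto simp: rat_intervals_def assms(1,2) sets_unit_leb_eq[unfolded rat_intervals_def]\<close>)

lemma measure_eqI_unit_square:
  assumes sets: "sets M = sets (unit_leb \<Otimes>\<^sub>M unit_leb)" "sets N = sets (unit_leb \<Otimes>\<^sub>M unit_leb)"
    and fin: "emeasure M ({0..1} \<times> {0..1}) \<noteq> \<infinity>"
    and eq: "\<And>p q. 0 \<le> p \<Longrightarrow> p \<le> 1 \<Longrightarrow> 0 \<le> q \<Longrightarrow> q \<le> 1 \<Longrightarrow>
      emeasure M ({0..p} \<times> {0..q}) = emeasure N ({0..p} \<times> {0..q})"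
  shows "M = N"
proof -
  let ?E = "{a \<times> b | a b. a \<in> rat_intervals \<and> b \<in> rat_intervals}"
  have sub: "?E \<subseteq> Pow ({0..1} \<times> {0..1})"
    using rat_intervals_subset by blast
  have "sets (unit_leb \<Otimes>\<^sub>M unit_leb) = sets (sigma (space unit_leb \<times> space unit_leb) ?E)"
    by (rule sets_pair_eq[where Ca = "{{0..1}}" and Cb = "{{0..1}}"])
       (use unit_interval_in_rat_intervals rat_intervals_subset sets_unit_leb_eq in \<open>auto simp: space_unit_leb\<close>)
  also have "\<dots> = sigma_sets ({0..1} \<times> {0..1}) ?E"
    using sub by (simp add: space_unit_leb)
  finally have gen: "sets (unit_leb \<Otimes>\<^sub>M unit_leb) = sigma_sets ({0..1} \<times> {0..1}) ?E" .
  show ?thesis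
  proof (rule measure_eqI_generator_eq[where A = "\<lambda>_. {0..1} \<times> {0..1}", OF _ sub])
    show "Int_stable ?E"
    proof (rule Int_stableI)
      fix u v assume "u \<in> ?E" "v \<in> ?E"
      then obtain a b c d where *: "u = a \<times> b" "v = c \<times> d" "a \<in> rat_intervals" "b \<in> rat_intervals"
        "c \<in> rat_intervals" "d \<in> rat_intervals"
        by blast
      then have "u \<inter> v = (a \<inter> c) \<times> (b \<inter> d)"
        by auto
      moreover have "a \<inter> c \<in> rat_intervals" "b \<inter> d \<in> rat_intervals"
        using * Int_stable_rat_intervals by (auto simp: Int_stable_def)
      ultimately show "u \<inter> v \<in> ?E"
        by blast
    qed
    fix X assume "X \<in> ?E"
    then obtain a b where *: "X = a \<times> b" "a \<in> rat_intervals" "b \<in> rat_intervals"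
      by blast
    then show "emeasure M X = emeasure N X"
      unfolding rat_intervals_def using eq by auto
  next
    show "range (\<lambda>_. {0..1} \<times> {0..1}) \<subseteq> ?E"
      using unit_interval_in_rat_intervals by blast
  qed (use fin in \<open>auto simp: assms(1,2) gen\<close>)
qed

section \<open>Uniqueness of the copula measure, the kernel and the components\<close>

lemma copula_measure_eqI:
  assumes "sets \<mu> = sets (unit_leb \<Otimes>\<^sub>M unit_leb)"
    and "\<And>x y. x \<in> {0..1} \<Longrightarrow> y \<in> {0..1} \<Longrightarrow> emeasure \<mu> ({0..x} \<times> {0..y}) = ennreal (C x y)"
  shows "copula_measure C = \<mu>"
  unfolding copula_measure_def
proof (rule the_equality)
  show "sets \<mu> = sets (unit_leb \<Otimes>\<^sub>M unit_leb) \<and>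
     (\<forall>x\<in>{0..1}. \<forall>y\<in>{0..1}. emeasure \<mu> ({0..x} \<times> {0..y}) = ennreal (C x y))"
    using assms by blast
next
  fix \<nu> assume \<nu>: "sets \<nu> = sets (unit_leb \<Otimes>\<^sub>M unit_leb) \<and>
     (\<forall>x\<in>{0..1}. \<forall>y\<in>{0..1}. emeasure \<nu> ({0..x} \<times> {0..y}) = ennreal (C x y))"
  then show "\<nu> = \<mu>"
    by (intro measure_eqI_unit_square) (auto simp: assms)
qed

text \<open>For one fixed \<open>F\<close> the two masses, as functions of \<open>x\<close>, are
  densities of the same measure and hence equal almost everywhere. The generator
  \<open>rat_intervals\<close> is countable, which allows a single exceptional null set for all its
  members; outside it the two measures agree on an intersection-stable generator.\<close>

lemma markov_kernel_AE_unique: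
  assumes K: "markov_kernel_of C K" and L: "markov_kernel_of C L"
  shows "AE x in unit_leb. K x = L x"
proof -
  interpret prob_space unit_leb
    by (rule prob_space_unit_leb)
  have Km: "K \<in> unit_leb \<rightarrow>\<^sub>M prob_algebra unit_leb" and Lm: "L \<in> unit_leb \<rightarrow>\<^sub>M prob_algebra unit_leb"
    using K L by (auto simp: markov_kernel_of_def)
  have "AE x in unit_leb. \<forall>F\<in>rat_intervals. emeasure (K x) F = emeasure (L x) F"
  proof (rule AE_ball_countable'[OF _ countable_rat_intervals])
    fix F assume "F \<in> rat_intervals"
    then have F: "F \<in> sets unit_leb"
      using rat_intervals_sets by auto
    have meas: "(\<lambda>x. emeasure (J x) F) \<in> borel_measurable unit_leb"
      if "J \<in> unit_leb \<rightarrow>\<^sub>M prob_algebra unit_leb" for J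
      using measurable_emeasure_kernel[OF measurable_prob_algebraD[OF that] F] .
    show "AE x in unit_leb. emeasure (K x) F = emeasure (L x) F"
      by (rule density_unique2) (use K L F meas Km Lm in \<open>auto simp: markov_kernel_of_def\<close>)
  qed
  moreover have "AE x in unit_leb. x \<in> space unit_leb"
    by (rule AE_space)
  ultimately show ?thesis
  proof eventually_elim
    case (elim x)
    have "K x \<in> space (prob_algebra unit_leb)" "L x \<in> space (prob_algebra unit_leb)"
      using measurable_space[OF Km] measurable_space[OF Lm] elim by auto
    then have p: "sets (K x) = sets unit_leb" "sets (L x) = sets unit_leb" "prob_space (K x)"
      by (auto simp: space_prob_algebra)
    then interpret Kx: prob_space "K x"
      by blast
    show ?case
    proof (rule measure_eqI_unit_leb[OF p(1,2)])
      show "emeasure (K x) {0..1} \<noteq> \<infinity>"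
        by simp
      fix q :: real assume "q \<in> \<rat>" "0 \<le> q" "q \<le> 1"
      then have "{0..q} \<in> rat_intervals"
        by (auto simp: rat_intervals_def)
      then show "emeasure (K x) {0..q} = emeasure (L x) {0..q}"
        using elim by blast
    qed
  qed
qed

lemma markov_kernel_AE_eq:
  assumes "markov_kernel_of C K"
  shows "AE x in unit_leb. markov_kernel C x = K x"
proof (rule markov_kernel_AE_unique[OF _ assms])
  show "markov_kernel_of C (markov_kernel C)"
    unfolding markov_kernel_def by (rule someI[of "markov_kernel_of C", OF assms])
qed

text \<open>Resolves both choices in \<open>copula_component\<close>: the version picked by
  \<open>markov_kernel\<close> agrees with \<open>K\<close> almost everywhere and enters only under
  integrals, and rectangle masses determine a finite measure. As \<open>Q\<close> is compared with
  \<open>P (K x)\<close> almost everywhere only, exceptional first arguments may be ignored.\<close>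

lemma copula_component_eqI:
  assumes K: "markov_kernel_of C K" and Q: "AE x in unit_leb. P (K x) = Q x"
    and sets: "sets \<nu> = sets (unit_leb \<Otimes>\<^sub>M unit_leb)"
    and fin: "emeasure \<nu> ({0..1} \<times> {0..1}) \<noteq> \<infinity>"
    and rect: "\<And>E F. E \<in> sets unit_leb \<Longrightarrow> F \<in> sets unit_leb \<Longrightarrow>
      emeasure \<nu> (E \<times> F) = (\<integral>\<^sup>+x\<in>E. emeasure (Q x) F \<partial>unit_leb)"
  shows "copula_component P C = \<nu>"
proof -
  have eq: "(\<integral>\<^sup>+x\<in>E. emeasure (P (markov_kernel C x)) F \<partial>unit_leb) = emeasure \<nu> (E \<times> F)"
    if "E \<in> sets unit_leb" "F \<in> sets unit_leb" for E F
    unfolding rect[OF that]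
    by (rule nn_integral_cong_AE) (use Q markov_kernel_AE_eq[OF K] in eventually_elim, simp)
  show ?thesis
    unfolding copula_component_def
  proof (rule the_equality)
    show "sets \<nu> = sets (unit_leb \<Otimes>\<^sub>M unit_leb) \<and> (\<forall>E\<in>sets unit_leb. \<forall>F\<in>sets unit_leb.
        emeasure \<nu> (E \<times> F) = (\<integral>\<^sup>+x\<in>E. emeasure (P (markov_kernel C x)) F \<partial>unit_leb))"
      using sets eq by simp
    fix \<mu> assume \<mu>: "sets \<mu> = sets (unit_leb \<Otimes>\<^sub>M unit_leb) \<and> (\<forall>E\<in>sets unit_leb. \<forall>F\<in>sets unit_leb.
        emeasure \<mu> (E \<times> F) = (\<integral>\<^sup>+x\<in>E. emeasure (P (markov_kernel C x)) F \<partial>unit_leb))"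
    have "\<nu> = \<mu>"
      by (rule measure_eqI_unit_square[OF sets _ fin]) (use \<mu> eq in \<open>auto simp: sets_unit_leb_iff\<close>)
    then show "\<mu> = \<nu>" ..
  qed
qed

section \<open>Lebesgue decompositions\<close>

definition sum_measure :: "'a measure \<Rightarrow> 'a measure \<Rightarrow> 'a measure" where
  "sum_measure M N = measure_of (space M) (sets M) (\<lambda>E. emeasure M E + emeasure N E)"

lemma sets_sum_measure [simp, measurable_cong]: "sets (sum_measure M N) = sets M"
  by (simp add: sum_measure_def)

lemma space_sum_measure [simp]: "space (sum_measure M N) = space M"
  by (simp add: sum_measure_def)

lemma emeasure_sum_measure:
  assumes "sets N = sets M"
  shows "emeasure (sum_measure M N) E = emeasure M E + emeasure N E"
proof (cases "E \<in> sets M")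
  case True
  show ?thesis
    unfolding sum_measure_def
  proof (rule emeasure_measure_of_sigma)
    show "sigma_algebra (space M) (sets M)"
      by (rule sets.sigma_algebra_axioms)
    show "positive (sets M) (\<lambda>E. emeasure M E + emeasure N E)"
      by (simp add: positive_def)
    show "countably_additive (sets M) (\<lambda>E. emeasure M E + emeasure N E)"
    proof (rule countably_additiveI)
      fix A :: "nat \<Rightarrow> _" assume A: "range A \<subseteq> sets M" "disjoint_family A"
      then have "(\<Sum>i. emeasure M (A i) + emeasure N (A i)) = (\<Sum>i. emeasure M (A i)) + (\<Sum>i. emeasure N (A i))"
        by (intro suminf_add[symmetric]) auto
      then show "(\<Sum>i. emeasure M (A i) + emeasure N (A i)) = emeasure M (\<Union>i. A i) + emeasure N (\<Union>i. A i)"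
        using A assms by (simp add: suminf_emeasure)
    qed
  qed fact
next
  case False
  then show ?thesis
    using assms by (simp add: emeasure_notin_sets)
qed

lemma emeasure_Int_add_Diff:
  assumes "E \<in> sets M" "S \<in> sets M"
  shows "emeasure M E = emeasure M (E \<inter> S) + emeasure M (E - S)"
proof -
  have "emeasure M (E \<inter> S) + emeasure M (E - S) = emeasure M (E \<inter> S \<union> (E - S))"
    using assms by (intro plus_emeasure) auto
  then show ?thesis
    by (simp add: Int_Diff_Un)
qed

lemma countable_sets_unit_leb: "countable D \<Longrightarrow> D \<subseteq> {0..1} \<Longrightarrow> D \<in> sets unit_leb"
  by (rule sets.countable) (auto simp: sets_unit_leb_iff)

lemma countable_null_sets_unit_leb: "countable D \<Longrightarrow> D \<subseteq> {0..1} \<Longrightarrow> D \<in> null_sets unit_leb"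
  by (simp add: null_sets_unit_leb_iff countable_imp_null_set_lborel)

lemma emeasure_countable_no_atoms:
  assumes "countable D" "\<And>x. x \<in> D \<Longrightarrow> {x} \<in> sets M" "\<And>x. x \<in> D \<Longrightarrow> emeasure M {x} = 0"
  shows "emeasure M D = 0"
proof -
  have "(\<Union>x\<in>D. {x}) \<in> null_sets M"
    using assms by (intro null_sets_UN') auto
  then show ?thesis
    by auto
qed

text \<open>The components of a Lebesgue decomposition are restrictions of the measure to sets that may
  be enlarged; comparing two decompositions on common larger sets gives uniqueness.\<close>

lemma lebesgue_decomposition_restrict:
  assumes dec: "lebesgue_decomposition M Ma Md Ms" and M: "sets M = sets unit_leb"
  obtains D N where "countable D" "D \<subseteq> N" "N \<in> null_sets unit_leb"
    "\<And>D' N' E. countable D' \<Longrightarrow> D \<subseteq> D' \<Longrightarrow> D' \<subseteq> N' \<Longrightarrow> N \<subseteq> N' \<Longrightarrow> N' \<in> null_sets unit_leb \<Longrightarrow> E \<in> sets M \<Longrightarrow>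
       emeasure Ma E = emeasure M (E - N') \<and> emeasure Md E = emeasure M (E \<inter> D') \<and>
       emeasure Ms E = emeasure M (E \<inter> (N' - D'))"
proof -
  have sets: "sets Ma = sets M" "sets Md = sets M" "sets Ms = sets M"
    and sum: "\<And>E. E \<in> sets M \<Longrightarrow> emeasure M E = emeasure Ma E + emeasure Md E + emeasure Ms E"
    and ac: "absolutely_continuous unit_leb Ma"
    using dec by (auto simp: lebesgue_decomposition_def)
  have space: "space M = {0..1}" "space Md = {0..1}" "space Ms = {0..1}"
    using sets M sets_eq_imp_space_eq[of _ unit_leb] by (auto simp: space_unit_leb)
  from dec obtain D where D: "D \<in> sets M" "countable D" "emeasure Md ({0..1} - D) = 0"
    by (auto simp: lebesgue_decomposition_def discrete_measure_def space)
  from dec obtain N where N: "N \<in> null_sets unit_leb" "emeasure Ms ({0..1} - N) = 0"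
    and atoms: "\<And>x. x \<in> {0..1} \<Longrightarrow> emeasure Ms {x} = 0"
    by (auto simp: lebesgue_decomposition_def singular_measure_def space)
  have D01: "D \<subseteq> {0..1}"
    using D sets.sets_into_space[OF D(1)] by (simp add: space)
  show thesis
  proof
    \<comment> \<open>The carrier of the singular part need not contain \<open>D\<close>; adding the
      countable \<open>D\<close> keeps it null.\<close>
    show "countable D" "D \<subseteq> N \<union> D" "N \<union> D \<in> null_sets unit_leb"
      using D N D01 by (auto intro: countable_null_sets_unit_leb)
    fix D' N' E assume D': "countable D'" "D \<subseteq> D'" "D' \<subseteq> N'" and N': "N \<union> D \<subseteq> N'" "N' \<in> null_sets unit_leb"
      and E: "E \<in> sets M"
    have "N' \<subseteq> {0..1}"
      using N' by (simp add: null_sets_unit_leb_iff)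
    then have "D' \<subseteq> {0..1}"
      using D' by blast
    from countable_sets_unit_leb[OF D'(1) this] have D'm: "D' \<in> sets M"
      by (simp only: M)
    from N'(2) have N'm: "N' \<in> sets M"
      by (simp only: M null_sets_def mem_Collect_eq)
    have a0: "emeasure Ma F = 0" if "F \<subseteq> N'" "F \<in> sets M" for F
    proof -
      have "F \<in> null_sets unit_leb"
        by (rule null_sets_subset[OF N'(2)]) (use that M in simp_all)
      then show ?thesis
        using ac by (auto simp: absolutely_continuous_def)
    qed
    have d0: "emeasure Md F = 0" if "F \<inter> D' = {}" "F \<in> sets M" for F
    proof -
      have "F \<subseteq> {0..1} - D"
        using that D' sets.sets_into_space[OF that(2)] space by auto
      moreover have "{0..1} - D \<in> sets Md"
        using D(1) sets(2) space(1) sets.compl_sets[of D M] by simp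
      ultimately have "emeasure Md F \<le> emeasure Md ({0..1} - D)"
        by (rule emeasure_mono)
      then show ?thesis
        using D by simp
    qed
    \<comment> \<open>\<open>F\<close> consists of a countable piece in \<open>D'\<close>, null
      because \<open>Ms\<close> has no atoms, and a piece that avoids \<open>N'\<close> and thus
      \<open>N\<close>.\<close>
    have s0: "emeasure Ms F = 0" if "F \<inter> (N' - D') = {}" "F \<in> sets M" for F
    proof -
      have Fsub: "F \<subseteq> {0..1}"
        using sets.sets_into_space[OF that(2)] space by auto
      have "emeasure Ms F = emeasure Ms (F \<inter> D') + emeasure Ms (F - D')"
        using that D'm sets by (intro emeasure_Int_add_Diff) auto
      moreover have "emeasure Ms (F \<inter> D') = 0"
      proof (rule emeasure_countable_no_atoms)
        show "countable (F \<inter> D')"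
          by (rule countable_subset[OF _ D'(1)]) simp
        fix x assume "x \<in> F \<inter> D'"
        then have "x \<in> {0..1}"
          using Fsub by blast
        then show "{x} \<in> sets Ms" "emeasure Ms {x} = 0"
          by (simp_all add: atoms sets(3) M sets_unit_leb_iff)
      qed
      moreover have "emeasure Ms (F - D') \<le> emeasure Ms ({0..1} - N)"
      proof (rule emeasure_mono)
        show "F - D' \<subseteq> {0..1} - N"
          using Fsub that(1) N'(1) by blast
        have "N \<in> sets M"
          using null_setsD2[OF N(1)] by (simp only: M)
        then show "{0..1} - N \<in> sets Ms"
          using sets(3) space(1) sets.compl_sets[of N M] by simp
      qed
      ultimately show ?thesis
        using N by simp
    qed
    have split: "emeasure P E = emeasure P (E - N') + emeasure P (E \<inter> D') + emeasure P (E \<inter> (N' - D'))"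
      if "sets P = sets M" for P
    proof -
      have "emeasure P E = emeasure P (E \<inter> N') + emeasure P (E - N')"
        using E N'm that by (intro emeasure_Int_add_Diff) auto
      also have "emeasure P (E \<inter> N') = emeasure P (E \<inter> N' \<inter> D') + emeasure P (E \<inter> N' - D')"
        using E N'm D'm that by (intro emeasure_Int_add_Diff) auto
      also have "E \<inter> N' \<inter> D' = E \<inter> D'"
        using D' by auto
      also have "E \<inter> N' - D' = E \<inter> (N' - D')"
        by auto
      finally show ?thesis
        by (simp add: ac_simps)
    qed
    have m: "E - N' \<in> sets M" "E \<inter> D' \<in> sets M" "E \<inter> (N' - D') \<in> sets M"
      using E N'm D'm by auto
    \<comment> \<open>Each component lives on one of the three cells, so on each cell
      \<open>sum\<close> reduces to a single term.\<close>
    have z: "emeasure Ma (E \<inter> D') = 0" "emeasure Ma (E \<inter> (N' - D')) = 0"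
      "emeasure Md (E - N') = 0" "emeasure Md (E \<inter> (N' - D')) = 0"
      "emeasure Ms (E - N') = 0" "emeasure Ms (E \<inter> D') = 0"
      using D' m by (auto intro!: a0 d0 s0)
    show "emeasure Ma E = emeasure M (E - N') \<and> emeasure Md E = emeasure M (E \<inter> D') \<and>
       emeasure Ms E = emeasure M (E \<inter> (N' - D'))"
      using split[OF sets(1)] split[OF sets(2)] split[OF sets(3)] sum[OF m(1)] sum[OF m(2)] sum[OF m(3)]
      by (simp add: z)
  qed
qed

lemma lebesgue_decomposition_unique:
  assumes M: "lebesgue_decomposition M Ma Md Ms" and N: "lebesgue_decomposition M Na Nd Ns"
    and s: "sets M = sets unit_leb"
  shows "Ma = Na" "Md = Nd" "Ms = Ns"
proof -
  from lebesgue_decomposition_restrict[OF M s] obtain D1 N1 where 1: "countable D1" "D1 \<subseteq> N1" "N1 \<in> null_sets unit_leb"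
    "\<And>D' N' E. countable D' \<Longrightarrow> D1 \<subseteq> D' \<Longrightarrow> D' \<subseteq> N' \<Longrightarrow> N1 \<subseteq> N' \<Longrightarrow> N' \<in> null_sets unit_leb \<Longrightarrow> E \<in> sets M \<Longrightarrow>
       emeasure Ma E = emeasure M (E - N') \<and> emeasure Md E = emeasure M (E \<inter> D') \<and>
       emeasure Ms E = emeasure M (E \<inter> (N' - D'))"
    by metis
  from lebesgue_decomposition_restrict[OF N s] obtain D2 N2 where 2: "countable D2" "D2 \<subseteq> N2" "N2 \<in> null_sets unit_leb"
    "\<And>D' N' E. countable D' \<Longrightarrow> D2 \<subseteq> D' \<Longrightarrow> D' \<subseteq> N' \<Longrightarrow> N2 \<subseteq> N' \<Longrightarrow> N' \<in> null_sets unit_leb \<Longrightarrow> E \<in> sets M \<Longrightarrow>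
       emeasure Na E = emeasure M (E - N') \<and> emeasure Nd E = emeasure M (E \<inter> D') \<and>
       emeasure Ns E = emeasure M (E \<inter> (N' - D'))"
    by metis
  have sets: "sets Ma = sets M" "sets Md = sets M" "sets Ms = sets M"
    "sets Na = sets M" "sets Nd = sets M" "sets Ns = sets M"
    using M N by (auto simp: lebesgue_decomposition_def)
  have *: "countable (D1 \<union> D2)" "D1 \<union> D2 \<subseteq> N1 \<union> N2" "N1 \<union> N2 \<in> null_sets unit_leb"
    using 1(1-3) 2(1-3) by auto
  have "emeasure Ma E = emeasure Na E \<and> emeasure Md E = emeasure Nd E \<and> emeasure Ms E = emeasure Ns E"
    if "E \<in> sets M" for E
    using 1(4)[OF *(1) _ *(2) _ *(3) that] 2(4)[OF *(1) _ *(2) _ *(3) that] by auto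
  then show "Ma = Na" "Md = Nd" "Ms = Ns"
    by (auto intro!: measure_eqI simp: sets)
qed

lemma lebesgue_decomposition_parts:
  assumes dec: "lebesgue_decomposition M Ma Md Ms" and s: "sets M = sets unit_leb"
  shows "abs_part M = Ma" "dis_part M = Md" "sing_part M = Ms"
  unfolding abs_part_def dis_part_def sing_part_def
  using dec lebesgue_decomposition_unique[OF dec _ s] by (blast intro: the_equality)+

text \<open>\<open>N\<close> absorbs all mass that \<open>M\<close> places on null sets, so the
  restriction to its complement is absolutely continuous; \<open>D\<close> contains every atom, so
  \<open>N - D\<close> is left with none. The three parts thus become restrictions of
  \<open>M\<close> to explicit sets.\<close>

lemma lebesgue_decomposition_densityI:
  assumes s: "sets M = sets unit_leb" and D: "countable D" "D \<subseteq> N" and N: "N \<in> null_sets unit_leb"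
    and atoms: "\<And>x. x \<in> {0..1} - D \<Longrightarrow> emeasure M {x} = 0"
    and null: "\<And>E. E \<in> null_sets unit_leb \<Longrightarrow> emeasure M (E - N) = 0"
  shows "abs_part M = density M (indicator ({0..1} - N))" "dis_part M = density M (indicator D)"
    "sing_part M = density M (indicator (N - D))"
proof -
  have space: "space M = {0..1}"
    using sets_eq_imp_space_eq[OF s] by (simp add: space_unit_leb)
  have N01: "N \<subseteq> {0..1}"
    using N by (simp add: null_sets_unit_leb_iff)
  have top: "{0..1} \<in> sets M"
    using sets.top[of M] by (simp add: space)
  have "D \<subseteq> {0..1}"
    using D N01 by blast
  from countable_sets_unit_leb[OF D(1) this] have Dm: "D \<in> sets M"
    by (simp only: s)
  have Nm: "N \<in> sets M"
    using null_setsD2[OF N] by (simp only: s)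
  have m: "{0..1} - N \<in> sets M" "D \<in> sets M" "N - D \<in> sets M"
    using top Dm Nm by simp_all
  have "lebesgue_decomposition M (density M (indicator ({0..1} - N))) (density M (indicator D)) (density M (indicator (N - D)))"
    unfolding lebesgue_decomposition_def
  proof (intro conjI ballI)
    fix E assume E: "E \<in> sets M"
    have E01: "E \<inter> {0..1} = E"
      using sets.sets_into_space[OF E] by (auto simp: space)
    have "emeasure M E = emeasure M (E \<inter> N) + emeasure M (E - N)"
      using E Nm Dm by (intro emeasure_Int_add_Diff) auto
    also have "emeasure M (E \<inter> N) = emeasure M (E \<inter> N \<inter> D) + emeasure M (E \<inter> N - D)"
      using E Nm Dm by (intro emeasure_Int_add_Diff) auto
    also have "E \<inter> N \<inter> D = E \<inter> D"
      using D by auto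
    also have "E \<inter> N - D = E \<inter> (N - D)"
      by auto
    finally have "emeasure M E = emeasure M (E - N) + emeasure M (E \<inter> D) + emeasure M (E \<inter> (N - D))"
      by (simp add: ac_simps)
    also have "E - N = ({0..1} - N) \<inter> E"
      using E01 by blast
    finally show "emeasure M E = emeasure (density M (indicator ({0..1} - N))) E + emeasure (density M (indicator D)) E +
        emeasure (density M (indicator (N - D))) E"
      using m E by (simp add: emeasure_restricted Int_commute[of E])
  next
    show "absolutely_continuous unit_leb (density M (indicator ({0..1} - N)))"
      unfolding absolutely_continuous_def
    proof
      fix E assume E: "E \<in> null_sets unit_leb"
      then have Em: "E \<in> sets M"
        by (simp only: s null_setsD2)
      have "({0..1} - N) \<inter> E = E - N"
        using sets.sets_into_space[OF Em] unfolding space by blast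
      then show "E \<in> null_sets (density M (indicator ({0..1} - N)))"
        using null[OF E] Em m by (intro null_setsI) (simp_all add: emeasure_restricted)
    qed
  next
    show "discrete_measure (density M (indicator D))"
      unfolding discrete_measure_def
      using Dm D(1) by (intro bexI[of _ D]) (simp_all add: emeasure_restricted)
  next
    show "singular_measure (density M (indicator (N - D)))"
      unfolding singular_measure_def
    proof (intro conjI ballI)
      have "(N - D) \<inter> (space M - N) = {}"
        by blast
      then show "\<exists>N'\<in>null_sets unit_leb. emeasure (density M (indicator (N - D))) (space (density M (indicator (N - D))) - N') = 0"
        using m Nm by (intro bexI[of _ N] N) (simp add: emeasure_restricted)
      fix x assume "x \<in> space (density M (indicator (N - D)))"
      then have x: "x \<in> {0..1}" "{x} \<in> sets M"
        by (auto simp: space s sets_unit_leb_iff)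
      then have "emeasure M ((N - D) \<inter> {x}) = 0"
        using atoms[of x] by (cases "x \<in> N - D") auto
      then show "emeasure (density M (indicator (N - D))) {x} = 0"
        using x m by (simp add: emeasure_restricted)
    qed
  qed simp_all
  from lebesgue_decomposition_parts[OF this s]
  show "abs_part M = density M (indicator ({0..1} - N))" "dis_part M = density M (indicator D)"
    "sing_part M = density M (indicator (N - D))"
    by auto
qed

text \<open>Exhaustion: null sets of nearly maximal mass have a null union, and \<open>N\<close>
  attains the supremum \<open>s\<close>. A null set with mass outside \<open>N\<close> could be
  joined to \<open>N\<close> and would exceed \<open>s\<close>.\<close>

lemma finite_measure_lebesgue_sets:
  assumes fin: "finite_measure M" and s: "sets M = sets unit_leb"
  obtains D N where "countable D" "D \<subseteq> N" "N \<in> null_sets unit_leb"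
    "\<And>x. x \<in> {0..1} \<Longrightarrow> x \<in> D \<longleftrightarrow> emeasure M {x} > 0"
    "\<And>E. E \<in> null_sets unit_leb \<Longrightarrow> emeasure M (E - N) = 0"
proof -
  interpret finite_measure M by fact
  define D where "D = {x \<in> {0..1}. measure M {x} \<noteq> 0}"
  have D: "countable D" "D \<subseteq> {0..1}"
    unfolding D_def by (auto intro: countable_subset[OF _ countable_support])
  define s where "s = (SUP E\<in>null_sets unit_leb. measure M E)"
  have bdd: "bdd_above (measure M ` null_sets unit_leb)"
    by (rule bdd_aboveI2[where M = "measure M (space M)"]) (rule bounded_measure)
  have ne: "null_sets unit_leb \<noteq> {}"
    by auto
  have "\<exists>E\<in>null_sets unit_leb. s - 1 / real (Suc n) < measure M E" for n
    using less_cSUP_iff[OF ne bdd, of "s - 1 / real (Suc n)"] by (simp add: s_def)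
  then obtain E where E: "\<And>n. E n \<in> null_sets unit_leb" "\<And>n. s - 1 / real (Suc n) < measure M (E n)"
    by metis
  define N where "N = D \<union> (\<Union>n. E n)"
  have N: "N \<in> null_sets unit_leb"
    unfolding N_def using E(1) countable_null_sets_unit_leb[OF D] by (intro null_sets.Un null_sets_UN) auto
  have Nm: "N \<in> sets M"
    using N assms(2) by auto
  have sN: "s \<le> measure M N"
  proof (rule field_le_epsilon)
    fix e :: real assume "e > 0"
    then obtain n where n: "1 / real (Suc n) < e"
      using nat_approx_posE by blast
    have "measure M (E n) \<le> measure M N"
      using Nm by (intro finite_measure_mono) (auto simp: N_def)
    then show "s \<le> measure M N + e"
      using n E(2)[of n] by linarith
  qed
  show thesis
  proof
    show "countable D" "D \<subseteq> N" "N \<in> null_sets unit_leb"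
      using D N by (auto simp: N_def)
    show "x \<in> D \<longleftrightarrow> emeasure M {x} > 0" if "x \<in> {0..1}" for x
      using that by (auto simp: D_def emeasure_eq_measure zero_less_measure_iff)
    fix F assume F: "F \<in> null_sets unit_leb"
    then have Fm: "F \<in> sets M"
      using assms(2) by auto
    have "measure M (N \<union> F) \<le> s"
      unfolding s_def using N F by (intro cSUP_upper bdd) auto
    moreover have "measure M (N \<union> (F - N)) = measure M N + measure M (F - N)"
      using Nm Fm by (intro finite_measure_Union) auto
    ultimately have "measure M (F - N) \<le> 0"
      using sN by simp
    then show "emeasure M (F - N) = 0"
      by (simp add: emeasure_eq_measure measure_le_0_iff)
  qed
qed

section \<open>Joint laws on the square built from kernels\<close>

definition kernel_measure :: "(real \<Rightarrow> real measure) \<Rightarrow> (real \<times> real) measure" where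
  "kernel_measure K = unit_leb \<bind> (\<lambda>x. distr (K x) (unit_leb \<Otimes>\<^sub>M unit_leb) (Pair x))"

context
  fixes K :: "real \<Rightarrow> real measure"
  assumes K: "K \<in> unit_leb \<rightarrow>\<^sub>M prob_algebra unit_leb"
begin

lemma kernel_sets: "x \<in> {0..1} \<Longrightarrow> sets (K x) = sets unit_leb"
  and kernel_prob: "x \<in> {0..1} \<Longrightarrow> prob_space (K x)"
  using measurable_space[OF K, of x] by (auto simp: space_prob_algebra space_unit_leb)

lemma kernel_distr_measurable:
  "(\<lambda>x. distr (K x) (unit_leb \<Otimes>\<^sub>M unit_leb) (Pair x)) \<in> unit_leb \<rightarrow>\<^sub>M subprob_algebra (unit_leb \<Otimes>\<^sub>M unit_leb)"
  by (rule measurable_distr2[OF _ measurable_prob_algebraD[OF K]]) simp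

lemma sets_kernel_measure: "sets (kernel_measure K) = sets (unit_leb \<Otimes>\<^sub>M unit_leb)"
  unfolding kernel_measure_def
  by (rule sets_bind[where N = "unit_leb \<Otimes>\<^sub>M unit_leb"]) (auto simp: space_unit_leb)

lemma emeasure_distr_Pair:
  assumes W: "W \<in> sets (unit_leb \<Otimes>\<^sub>M unit_leb)" and x: "x \<in> {0..1}"
  shows "emeasure (distr (K x) (unit_leb \<Otimes>\<^sub>M unit_leb) (Pair x)) W = emeasure (K x) (Pair x -` W)"
proof -
  have "space (K x) = {0..1}"
    using sets_eq_imp_space_eq[OF kernel_sets[OF x]] by (simp add: space_unit_leb)
  moreover have "Pair x -` W \<subseteq> {0..1}"
    using sets.sets_into_space[OF W] by (auto simp: space_pair_measure space_unit_leb)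
  moreover have "Pair x \<in> K x \<rightarrow>\<^sub>M unit_leb \<Otimes>\<^sub>M unit_leb"
    unfolding measurable_cong_sets[OF kernel_sets[OF x] refl]
    by (rule measurable_Pair1') (use x in \<open>simp add: space_unit_leb\<close>)
  ultimately show ?thesis
    using W by (subst emeasure_distr) (auto simp: Int_absorb2)
qed

lemma kernel_section_measurable:
  assumes W: "W \<in> sets (unit_leb \<Otimes>\<^sub>M unit_leb)"
  shows "(\<lambda>x. emeasure (K x) (Pair x -` W)) \<in> borel_measurable unit_leb"
proof -
  have "(\<lambda>x. emeasure (distr (K x) (unit_leb \<Otimes>\<^sub>M unit_leb) (Pair x)) W) \<in> borel_measurable unit_leb"
    by (rule measurable_emeasure_kernel[OF kernel_distr_measurable W])
  then show ?thesis
    by (rule measurable_cong[THEN iffD1, rotated]) (simp add: emeasure_distr_Pair[OF W] space_unit_leb)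
qed

lemma emeasure_kernel_measure:
  assumes W: "W \<in> sets (unit_leb \<Otimes>\<^sub>M unit_leb)"
  shows "emeasure (kernel_measure K) W = (\<integral>\<^sup>+x. emeasure (K x) (Pair x -` W) \<partial>unit_leb)"
proof -
  have "emeasure (kernel_measure K) W =
      (\<integral>\<^sup>+x. emeasure (distr (K x) (unit_leb \<Otimes>\<^sub>M unit_leb) (Pair x)) W \<partial>unit_leb)"
    unfolding kernel_measure_def
    by (rule emeasure_bind[OF _ kernel_distr_measurable W]) (simp add: space_unit_leb)
  also have "\<dots> = (\<integral>\<^sup>+x. emeasure (K x) (Pair x -` W) \<partial>unit_leb)"
    by (intro nn_integral_cong emeasure_distr_Pair[OF W]) (simp add: space_unit_leb)
  finally show ?thesis .
qed

lemma emeasure_kernel_measure_times: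
  assumes "E \<in> sets unit_leb" "F \<in> sets unit_leb"
  shows "emeasure (kernel_measure K) (E \<times> F) = (\<integral>\<^sup>+x\<in>E. emeasure (K x) F \<partial>unit_leb)"
  using assms
  by (subst emeasure_kernel_measure)
     (auto intro!: nn_integral_cong simp: indicator_def vimage_def)

text \<open>As \<open>W\<close> is one measurable set of the square, restricting the joint law to it
  gives a finite measure whose rectangle masses are integrals of the restricted kernels; uniqueness
  then identifies it with the component.\<close>

lemma copula_component_restrict:
  assumes C: "markov_kernel_of C K" and W: "W \<in> sets (unit_leb \<Otimes>\<^sub>M unit_leb)"
    and P: "AE x in unit_leb. P (K x) = density (K x) (indicator (Pair x -` W))"
  shows "emeasure (copula_component P C) ({0..1} \<times> {0..1}) = (\<integral>\<^sup>+x. emeasure (K x) (Pair x -` W) \<partial>unit_leb)"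
proof -
  define \<nu> where "\<nu> = density (kernel_measure K) (indicator W)"
  have W': "W \<in> sets (kernel_measure K)"
    using W by (simp add: sets_kernel_measure)
  have dens: "emeasure \<nu> V = (\<integral>\<^sup>+x. emeasure (K x) (Pair x -` (W \<inter> V)) \<partial>unit_leb)"
    if "V \<in> sets (unit_leb \<Otimes>\<^sub>M unit_leb)" for V
    using that W W' emeasure_kernel_measure[of "W \<inter> V"]
    by (simp add: \<nu>_def emeasure_restricted sets_kernel_measure)
  have space: "space (unit_leb \<Otimes>\<^sub>M unit_leb) = {0..1} \<times> {0..1}"
    by (simp add: space_pair_measure space_unit_leb)
  have WI: "W \<inter> ({0..1} \<times> {0..1}) = W"
    using sets.sets_into_space[OF W] space by auto
  have tot: "emeasure \<nu> ({0..1} \<times> {0..1}) = (\<integral>\<^sup>+x. emeasure (K x) (Pair x -` W) \<partial>unit_leb)"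
    using dens[of "{0..1} \<times> {0..1}"] sets.top[of "unit_leb \<Otimes>\<^sub>M unit_leb"] by (simp add: space WI)
  have "copula_component P C = \<nu>"
  proof (rule copula_component_eqI[OF C P])
    show "sets \<nu> = sets (unit_leb \<Otimes>\<^sub>M unit_leb)"
      by (simp add: \<nu>_def sets_kernel_measure)
    have "(\<integral>\<^sup>+x. emeasure (K x) (Pair x -` W) \<partial>unit_leb) \<le> (\<integral>\<^sup>+x. 1 \<partial>unit_leb)"
      by (intro nn_integral_mono)
         (use kernel_prob in \<open>auto simp: space_unit_leb intro: prob_space.emeasure_le_1 subprob_space.subprob_emeasure_le_1 prob_space_imp_subprob_space\<close>)
    also have "\<dots> = 1"
      using prob_space.emeasure_space_1[OF prob_space_unit_leb] by simp
    finally show "emeasure \<nu> ({0..1} \<times> {0..1}) \<noteq> \<infinity>"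
      by (simp add: tot top_unique) (metis ennreal_one_neq_top top.extremum_unique)
    fix E F assume EF: "E \<in> sets unit_leb" "F \<in> sets unit_leb"
    have "emeasure \<nu> (E \<times> F) = (\<integral>\<^sup>+x. emeasure (K x) (Pair x -` (W \<inter> E \<times> F)) \<partial>unit_leb)"
      using EF by (intro dens) auto
    also have "\<dots> = (\<integral>\<^sup>+x\<in>E. emeasure (density (K x) (indicator (Pair x -` W))) F \<partial>unit_leb)"
    proof (rule nn_integral_cong)
      fix x assume "x \<in> space unit_leb"
      then have x: "x \<in> {0..1}"
        by (simp add: space_unit_leb)
      have Wx: "Pair x -` W \<in> sets (K x)"
        unfolding kernel_sets[OF x] by (rule sets_Pair1[OF W])
      have F: "F \<in> sets (K x)"
        using EF kernel_sets[OF x] by simp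
      have "emeasure (density (K x) (indicator (Pair x -` W))) F = emeasure (K x) (Pair x -` W \<inter> F)"
        by (rule emeasure_restricted[OF Wx F])
      then show "emeasure (K x) (Pair x -` (W \<inter> E \<times> F)) =
          emeasure (density (K x) (indicator (Pair x -` W))) F * indicator E x"
        by (auto simp: indicator_def vimage_def Int_def intro: arg_cong[of _ _ "emeasure (K x)"])
    qed
    finally show "emeasure \<nu> (E \<times> F) =
        (\<integral>\<^sup>+x\<in>E. emeasure (density (K x) (indicator (Pair x -` W))) F \<partial>unit_leb)" .
  qed
  then show ?thesis
    by (simp add: tot)
qed

end

section \<open>The Pickands dependence function and its derivative\<close>

text \<open>The triangles \<open>u < s \<le> t\<close> and \<open>s \<le> u \<le> t\<close> partition a quadrant, so this is Tonelli's theorem.\<close>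

lemma nn_integral_cdf_mult:
  fixes M N :: "real measure" and f g :: "real \<Rightarrow> ennreal"
  assumes "sigma_finite_measure M" "sigma_finite_measure N"
    and sets [measurable_cong]: "sets M = sets borel" "sets N = sets borel"
    and [measurable]: "f \<in> borel_measurable borel" "g \<in> borel_measurable borel"
  shows "(\<integral>\<^sup>+s. f s * indicator {..t} s * (\<integral>\<^sup>+u\<in>{..<s}. g u \<partial>N) \<partial>M) +
      (\<integral>\<^sup>+u. g u * indicator {..t} u * (\<integral>\<^sup>+s\<in>{..u}. f s \<partial>M) \<partial>N) =
    (\<integral>\<^sup>+s\<in>{..t}. f s \<partial>M) * (\<integral>\<^sup>+u\<in>{..t}. g u \<partial>N)"
proof -
  interpret pair_sigma_finite N M
    using assms by (simp add: pair_sigma_finite_def)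
  note [measurable_cong] = sets
  have 1: "(\<integral>\<^sup>+s. f s * indicator {..t} s * (\<integral>\<^sup>+u\<in>{..<s}. g u \<partial>N) \<partial>M) =
      (\<integral>\<^sup>+s. (\<integral>\<^sup>+u. (if s \<le> t \<and> u < s then f s * g u else 0) \<partial>N) \<partial>M)"
    by (subst nn_integral_cmult[symmetric]) (auto intro!: nn_integral_cong simp: indicator_def ac_simps)
  have "(\<integral>\<^sup>+u. g u * indicator {..t} u * (\<integral>\<^sup>+s\<in>{..u}. f s \<partial>M) \<partial>N) =
      (\<integral>\<^sup>+u. (\<integral>\<^sup>+s. (if u \<le> t \<and> s \<le> u then f s * g u else 0) \<partial>M) \<partial>N)"
    by (subst nn_integral_cmult[symmetric]) (auto intro!: nn_integral_cong simp: indicator_def ac_simps)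
  also have "\<dots> = (\<integral>\<^sup>+s. (\<integral>\<^sup>+u. (if u \<le> t \<and> s \<le> u then f s * g u else 0) \<partial>N) \<partial>M)"
    by (rule Fubini'[symmetric]) measurable
  finally have "(\<integral>\<^sup>+s. f s * indicator {..t} s * (\<integral>\<^sup>+u\<in>{..<s}. g u \<partial>N) \<partial>M) +
      (\<integral>\<^sup>+u. g u * indicator {..t} u * (\<integral>\<^sup>+s\<in>{..u}. f s \<partial>M) \<partial>N) =
      (\<integral>\<^sup>+s. (\<integral>\<^sup>+u. (if s \<le> t \<and> u < s then f s * g u else 0) \<partial>N) +
        (\<integral>\<^sup>+u. (if u \<le> t \<and> s \<le> u then f s * g u else 0) \<partial>N) \<partial>M)"
    unfolding 1 by (subst nn_integral_add) measurable
  also have "\<dots> = (\<integral>\<^sup>+s. (\<integral>\<^sup>+u. (if s \<le> t \<and> u < s then f s * g u else 0) +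
        (if u \<le> t \<and> s \<le> u then f s * g u else 0) \<partial>N) \<partial>M)"
    by (subst nn_integral_add) auto
  also have "\<dots> = (\<integral>\<^sup>+s. (\<integral>\<^sup>+u. f s * indicator {..t} s * (g u * indicator {..t} u) \<partial>N) \<partial>M)"
    by (intro nn_integral_cong) (auto simp: indicator_def)
  also have "\<dots> = (\<integral>\<^sup>+s. f s * indicator {..t} s * (\<integral>\<^sup>+u\<in>{..t}. g u \<partial>N) \<partial>M)"
    by (subst nn_integral_cmult) auto
  also have "\<dots> = (\<integral>\<^sup>+s\<in>{..t}. f s \<partial>M) * (\<integral>\<^sup>+u\<in>{..t}. g u \<partial>N)"
    by (subst nn_integral_multc) auto
  finally show ?thesis .
qed

locale pickands =
  fixes \<theta> :: "real measure" and A :: "real \<Rightarrow> real"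
  assumes pickands_measure: "pickands_measure \<theta>"
    and pickands_function: "pickands_function A"
    and correspondence: "pickands_function_of_measure \<theta> A"
begin

text \<open>\<theta> lives on the \<sigma>-algebra of the unit interval; its extension by zero to
  the line makes distribution functions and Borel integrals available.\<close>

definition \<tau> :: "real measure" where
  "\<tau> = distr \<theta> borel (\<lambda>x. x)"

lemma sets_\<theta>: "sets \<theta> = sets unit_leb"
  using pickands_measure by (simp add: pickands_measure_def)

lemma space_\<theta>: "space \<theta> = {0..1}"
  using sets_eq_imp_space_eq[OF sets_\<theta>] by (simp add: space_unit_leb)

lemma id_measurable_\<theta>: "(\<lambda>x. x) \<in> \<theta> \<rightarrow>\<^sub>M borel"
  unfolding measurable_cong_sets[OF sets_\<theta> refl]
  by (rule measurable_restrict_space1) simp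

lemma sets_\<tau> [simp, measurable_cong]: "sets \<tau> = sets borel"
  by (simp add: \<tau>_def)

lemma emeasure_\<tau>: "E \<in> sets borel \<Longrightarrow> emeasure \<tau> E = emeasure \<theta> (E \<inter> {0..1})"
  unfolding \<tau>_def by (subst emeasure_distr[OF id_measurable_\<theta>]) (auto simp: space_\<theta>)

sublocale \<theta>: prob_space \<theta>
  using pickands_measure by (simp add: pickands_measure_def)

sublocale \<tau>: real_distribution \<tau>
  unfolding \<tau>_def by (rule \<theta>.real_distribution_distr) (rule id_measurable_\<theta>)

definition \<Theta> :: "real \<Rightarrow> real" where
  "\<Theta> = cdf \<tau>"

lemma \<Theta>_mono: "mono \<Theta>"
  unfolding \<Theta>_def by (intro monoI \<tau>.cdf_nondecreasing)

lemma \<Theta>_measurable [measurable]: "\<Theta> \<in> borel_measurable borel"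
  by (rule borel_measurable_mono[OF \<Theta>_mono])

lemma \<Theta>_nonneg: "0 \<le> \<Theta> t" and \<Theta>_le_1: "\<Theta> t \<le> 1"
  unfolding \<Theta>_def by (auto intro: \<tau>.cdf_nonneg \<tau>.cdf_bounded_prob)

lemma emeasure_\<tau>_atMost: "emeasure \<tau> {..t} = ennreal (\<Theta> t)"
  by (simp add: \<Theta>_def cdf_def \<tau>.emeasure_eq_measure)

lemma \<Theta>_eq: "0 \<le> z \<Longrightarrow> z \<le> 1 \<Longrightarrow> \<Theta> z = measure \<theta> {0..z}"
proof -
  assume "0 \<le> z" "z \<le> 1"
  then have "{..z} \<inter> {0..1} = {0..z}"
    by auto
  moreover have "emeasure \<tau> {..z} = emeasure \<theta> ({..z} \<inter> {0..1})"
    by (rule emeasure_\<tau>) simp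
  ultimately show ?thesis
    by (simp only: \<Theta>_def cdf_def measure_def)
qed

lemma \<Theta>_neg: "z < 0 \<Longrightarrow> \<Theta> z = 0"
proof -
  assume "z < 0"
  then have "{..z} \<inter> {0..1} = {}"
    by auto
  then show ?thesis
    by (simp add: \<Theta>_def cdf_def measure_def emeasure_\<tau>)
qed

definition J :: "real set" where
  "J = {t. \<not> isCont \<Theta> t}"

text \<open>Discontinuities of a distribution function are the atoms of its measure, and a finite
  measure has only countably many.\<close>

lemma countable_J: "countable J"
  using \<tau>.countable_atoms by (simp add: J_def \<Theta>_def \<tau>.isCont_cdf zero_less_measure_iff)

lemma \<Theta>_integrable: "set_integrable lborel {a..b} \<Theta>"
  unfolding set_integrable_def
proof (rule Bochner_Integration.integrable_bound)
  show "integrable lborel (indicator {a..b} :: real \<Rightarrow> real)"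
    by (intro integrable_real_indicator) (simp_all add: emeasure_lborel_Icc_eq)
  show "AE x in lborel. norm (indicator {a..b} x *\<^sub>R \<Theta> x) \<le> norm (indicator {a..b} x :: real)"
    by (intro AE_I2) (simp add: indicator_def \<Theta>_nonneg \<Theta>_le_1)
qed simp

lemma A_eq:
  assumes "t \<in> {0..1}"
  shows "A t = 1 - t + 2 * integral {0..t} \<Theta>"
proof -
  have "(LINT z:{0..t}|lborel. measure \<theta> {0..z}) = (LINT z:{0..t}|lborel. \<Theta> z)"
    by (intro set_lebesgue_integral_cong) (use assms in \<open>auto simp: \<Theta>_eq\<close>)
  also have "\<dots> = integral {0..t} \<Theta>"
    by (rule set_borel_integral_eq_integral(2)[OF \<Theta>_integrable])
  finally show ?thesis
    using correspondence assms by (simp add: pickands_function_of_measure_def)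
qed

lemma A_ge: "t \<in> {0..1} \<Longrightarrow> 1 - t \<le> A t" "t \<in> {0..1} \<Longrightarrow> t \<le> A t"
  and A_le: "t \<in> {0..1} \<Longrightarrow> A t \<le> 1"
  using pickands_function by (auto simp: pickands_function_def)

lemma A_0: "A 0 = 1" and A_1: "A 1 = 1"
  using A_ge[of 0] A_le[of 0] A_ge[of 1] A_le[of 1] by auto

lemma A_continuous: "continuous_on {0..1} A"
proof -
  have "continuous_on {0..1} (\<lambda>t. 1 - t + 2 * integral {0..t} \<Theta>)"
    by (intro continuous_on_add continuous_on_diff continuous_on_mult continuous_on_const continuous_on_id
          indefinite_integral_continuous_1 set_borel_integral_eq_integral(1) \<Theta>_integrable)
  then show ?thesis
    by (rule continuous_on_eq) (simp add: A_eq)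
qed

lemma A_deriv:
  assumes t: "t \<in> {0<..<1}" and cont: "t \<notin> J"
  shows "(A has_real_derivative (2 * \<Theta> t - 1)) (at t)"
proof -
  have "((\<lambda>u. integral {0..u} \<Theta>) has_vector_derivative \<Theta> t) (at t within {0..1} - {})"
    using t cont by (intro integral_has_vector_derivative_continuous_at set_borel_integral_eq_integral(1) \<Theta>_integrable)
      (auto simp: J_def intro: continuous_at_imp_continuous_within)
  moreover have "at t within {0..1} = at t"
    using t by (intro at_within_interior) auto
  ultimately have "((\<lambda>u. integral {0..u} \<Theta>) has_real_derivative \<Theta> t) (at t)"
    by (simp add: has_real_derivative_iff_has_vector_derivative)
  then have "((\<lambda>u. 1 - u + 2 * integral {0..u} \<Theta>) has_real_derivative (2 * \<Theta> t - 1)) (at t)"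
    by (auto intro!: derivative_eq_intros)
  then show ?thesis
    by (rule has_field_derivative_transform_within_open[where S = "{0<..<1}"]) (use t in \<open>auto simp: A_eq\<close>)
qed

lemma A_cont: "t \<in> {0<..<1} \<Longrightarrow> isCont A t"
  using continuous_on_interior[OF A_continuous, of t] by simp

text \<open>\<open>A\<close> is unspecified off the unit interval; \<open>A_ext\<close> is a globally continuous, hence Borel,
  extension.\<close>

definition A_ext :: "real \<Rightarrow> real" where
  "A_ext t = A (max 0 (min 1 t))"

lemma A_ext_eq: "t \<in> {0..1} \<Longrightarrow> A_ext t = A t"
  by (simp add: A_ext_def)

lemma A_ext_continuous: "isCont A_ext t"
proof -
  have "continuous_on UNIV (A \<circ> (\<lambda>t. max 0 (min 1 t)))"
    by (intro continuous_on_compose continuous_on_max continuous_on_min continuous_on_const continuous_on_id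
          continuous_on_subset[OF A_continuous]) auto
  then show ?thesis
    by (simp add: A_ext_def[abs_def] comp_def continuous_on_eq_continuous_at)
qed

lemma A_ext_measurable [measurable]: "A_ext \<in> borel_measurable borel"
  by (simp add: borel_measurable_continuous_onI continuous_on_eq_continuous_at A_ext_continuous)

text \<open>The second factor is the derivative of \<open>A\<close>; \<open>G\<close> is the distribution function of
  \<open>2 (1 - s) d\<theta>(s)\<close>.\<close>

definition G :: "real \<Rightarrow> real" where
  "G t = A_ext t + (1 - t) * (2 * \<Theta> t - 1)"

lemma G_measurable [measurable]: "G \<in> borel_measurable borel"
  unfolding G_def by measurable

lemma G_nonneg: "t \<in> {0..1} \<Longrightarrow> 0 \<le> G t"
proof -
  assume t: "t \<in> {0..1}"
  then have "(1 - t) * (- 1) \<le> (1 - t) * (2 * \<Theta> t - 1)"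
    using \<Theta>_nonneg[of t] by (intro mult_left_mono) auto
  then show ?thesis
    using A_ge[OF t] by (simp add: G_def A_ext_eq[OF t])
qed

lemma G_le: "t \<in> {0..1} \<Longrightarrow> G t \<le> 2"
proof -
  assume t: "t \<in> {0..1}"
  then have "(1 - t) * (2 * \<Theta> t - 1) \<le> (1 - t) * 1"
    using \<Theta>_le_1[of t] by (intro mult_left_mono) auto
  then show ?thesis
    using A_le[OF t] t by (simp add: G_def A_ext_eq[OF t])
qed

lemma G_1: "G 1 = 1"
  by (simp add: G_def A_ext_eq A_1)

text \<open>For \<open>s \<le> t\<close> write \<open>2 * (1 - s)\<close> as
  \<open>2 * (t - s) + 2 * (1 - t)\<close>. By Tonelli the positive part of \<open>t - s\<close>
  integrates to the integral of \<Theta> over \<open>{0..t}\<close>, and twice this integral is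
  \<open>A t\<close> up to an affine term.\<close>

lemma nn_integral_\<tau>_atMost:
  assumes t: "t \<in> {0..1}"
  shows "(\<integral>\<^sup>+s\<in>{..t}. ennreal (2 * (1 - s)) \<partial>\<tau>) = ennreal (G t)"
proof -
  interpret P: pair_sigma_finite \<tau> lborel
    by (simp add: pair_sigma_finite_def \<tau>.sigma_finite_measure_axioms lborel.sigma_finite_measure_axioms)
  define I where "I = integral {0..t} \<Theta>"
  have I: "0 \<le> I"
    unfolding I_def by (intro integral_nonneg set_borel_integral_eq_integral(1) \<Theta>_integrable) (auto simp: \<Theta>_nonneg)
  \<comment> \<open>\<open>ennreal\<close> maps negative numbers to 0, so
    \<open>ennreal (t - s)\<close> is the positive part, that is, the length of
    \<open>{s..t}\<close>.\<close>
  have "(\<integral>\<^sup>+s. ennreal (t - s) \<partial>\<tau>) = (\<integral>\<^sup>+s. (\<integral>\<^sup>+z. indicator {s..t} z \<partial>lborel) \<partial>\<tau>)"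
    by (intro nn_integral_cong) (simp add: ennreal_neg emeasure_lborel_Icc_eq)
  also have "\<dots> = (\<integral>\<^sup>+s. (\<integral>\<^sup>+z. (if s \<le> z \<and> z \<le> t then 1 else 0) \<partial>lborel) \<partial>\<tau>)"
    by (intro nn_integral_cong) (simp add: indicator_def)
  also have "\<dots> = (\<integral>\<^sup>+z. (\<integral>\<^sup>+s. (if s \<le> z \<and> z \<le> t then 1 else 0) \<partial>\<tau>) \<partial>lborel)"
    by (rule P.Fubini'[symmetric]) measurable
  also have "\<dots> = (\<integral>\<^sup>+z. (\<integral>\<^sup>+s. indicator {..z} s * indicator {..t} z \<partial>\<tau>) \<partial>lborel)"
    by (intro nn_integral_cong) (simp add: indicator_def)
  also have "\<dots> = (\<integral>\<^sup>+z. emeasure \<tau> {..z} * indicator {..t} z \<partial>lborel)"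
    by (subst nn_integral_multc) auto
  also have "\<dots> = (\<integral>\<^sup>+z\<in>{0..t}. ennreal (\<Theta> z) \<partial>lborel)"
    by (intro nn_integral_cong) (auto simp: emeasure_\<tau>_atMost indicator_def \<Theta>_neg not_le)
  also have "\<dots> = ennreal I"
    using nn_integral_has_integral_lebesgue'[of "{0..t}" \<Theta> I] \<Theta>_nonneg
      integrable_integral[OF set_borel_integral_eq_integral(1)[OF \<Theta>_integrable[of 0 t]]]
    by (simp add: I_def)
  finally have 1: "(\<integral>\<^sup>+s. ennreal (t - s) \<partial>\<tau>) = ennreal I" .
  have "(\<integral>\<^sup>+s\<in>{..t}. ennreal (2 * (1 - s)) \<partial>\<tau>) =
      (\<integral>\<^sup>+s. ennreal 2 * ennreal (t - s) + ennreal (2 * (1 - t)) * indicator {..t} s \<partial>\<tau>)"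
  proof (rule nn_integral_cong)
    fix s
    show "ennreal (2 * (1 - s)) * indicator {..t} s =
        ennreal 2 * ennreal (t - s) + ennreal (2 * (1 - t)) * indicator {..t} s"
    proof (cases "s \<le> t")
      case True
      have "ennreal (2 * (1 - s)) = ennreal (2 * (t - s) + 2 * (1 - t))"
        by (simp add: algebra_simps)
      also have "\<dots> = ennreal (2 * (t - s)) + ennreal (2 * (1 - t))"
        using True t by (intro ennreal_plus) auto
      also have "ennreal (2 * (t - s)) = ennreal 2 * ennreal (t - s)"
        using True by (intro ennreal_mult) auto
      finally show ?thesis
        using True by simp
    qed (simp add: ennreal_neg)
  qed
  also have "\<dots> = ennreal 2 * ennreal I + ennreal (2 * (1 - t)) * ennreal (\<Theta> t)"
    by (simp add: nn_integral_add nn_integral_cmult 1 emeasure_\<tau>_atMost)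
  also have "\<dots> = ennreal (2 * I + 2 * (1 - t) * \<Theta> t)"
  proof -
    have "ennreal (2 * I + 2 * (1 - t) * \<Theta> t) = ennreal (2 * I) + ennreal (2 * (1 - t) * \<Theta> t)"
      using t I \<Theta>_nonneg[of t] by (intro ennreal_plus) auto
    also have "ennreal (2 * I) = ennreal 2 * ennreal I"
      using I by (intro ennreal_mult) auto
    also have "ennreal (2 * (1 - t) * \<Theta> t) = ennreal (2 * (1 - t)) * ennreal (\<Theta> t)"
      using t \<Theta>_nonneg[of t] by (intro ennreal_mult) auto
    finally show ?thesis ..
  qed
  also have "2 * I + 2 * (1 - t) * \<Theta> t = G t"
    using t by (simp add: G_def A_ext_eq A_eq I_def algebra_simps)
  finally show ?thesis .
qed

text \<open>At \<open>s = angle x y\<close> this is \<open>C x y / x\<close>. For \<open>x\<close>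
  in the open unit interval the value 0 at \<open>s = 0\<close> is the limit, because
  \<open>A s / s\<close> tends to infinity and \<open>ln x\<close> is negative; so
  \<open>h x\<close> is continuous on the closed interval.\<close>

definition h :: "real \<Rightarrow> real \<Rightarrow> real" where
  "h x s = (if 0 < s then exp (ln x * (A_ext s / s - 1)) else 0)"

text \<open>The chain rule with \<open>2 * \<Theta> s - 1\<close> in place of the derivative of
  \<open>A\<close>. Only off \<open>J\<close> is it claimed to be the derivative of
  \<open>h x\<close>, but it is defined and Borel everywhere.\<close>

definition h' :: "real \<Rightarrow> real \<Rightarrow> real" where
  "h' x s = h x s * (- ln x) / s\<^sup>2 * (A_ext s - s * (2 * \<Theta> s - 1))"

lemma h_measurable [measurable]: "(\<lambda>p. h (fst p) (snd p)) \<in> borel_measurable (borel \<Otimes>\<^sub>M borel)"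
  unfolding h_def by measurable

lemma h_measurable' [measurable]: "h x \<in> borel_measurable borel" "h' x \<in> borel_measurable borel"
  unfolding h_def[abs_def] h'_def[abs_def] by measurable

lemma h_nonneg: "0 \<le> h x s"
  by (simp add: h_def)

lemma h_pos: "0 < s \<Longrightarrow> 0 < h x s"
  by (simp add: h_def)

lemma h_1: "h x 1 = 1"
  by (simp add: h_def A_ext_eq A_1)

lemma h_le_1:
  assumes x: "x \<in> {0<..<1}" and s: "s \<in> {0..1}"
  shows "h x s \<le> 1"
proof (cases "0 < s")
  case True
  then have "0 \<le> A_ext s / s - 1"
    using A_ge(2)[OF s] s by (simp add: A_ext_eq[OF s] field_simps)
  then have "ln x * (A_ext s / s - 1) \<le> 0"
    using x by (intro mult_nonpos_nonneg) auto
  then show ?thesis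
    using True by (simp add: h_def)
qed (simp add: h_def)

text \<open>Where \<open>A\<close> is differentiable, the expression is the height at 0 of its
  tangent at \<open>s\<close>. Nonnegativity makes \<open>h x\<close> increasing for
  \<open>x\<close> in the open unit interval, and the upper bound controls \<open>h'\<close> away
  from 0.\<close>

lemma h_slope_bounds:
  assumes s: "s \<in> {0..1}"
  shows "0 \<le> A_ext s - s * (2 * \<Theta> s - 1)" "A_ext s - s * (2 * \<Theta> s - 1) \<le> 2"
proof -
  have "s * (2 * \<Theta> s - 1) \<le> s * 1" "s * (- 1) \<le> s * (2 * \<Theta> s - 1)"
    by (rule mult_left_mono; use s \<Theta>_le_1[of s] \<Theta>_nonneg[of s] in simp)+
  then show "0 \<le> A_ext s - s * (2 * \<Theta> s - 1)" "A_ext s - s * (2 * \<Theta> s - 1) \<le> 2"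
    using A_ge(2)[OF s] A_le[OF s] s by (auto simp: A_ext_eq[OF s])
qed

lemma h'_nonneg:
  assumes "x \<in> {0<..<1}" "s \<in> {0..1}"
  shows "0 \<le> h' x s"
  unfolding h'_def using assms h_slope_bounds[of s] h_nonneg
  by (intro mult_nonneg_nonneg divide_nonneg_nonneg) auto

lemma h_continuous:
  assumes x: "x \<in> {0<..<1}"
  shows "continuous_on {0..1} (h x)"
  unfolding continuous_on_def
proof
  fix s :: real assume s: "s \<in> {0..1}"
  show "(h x \<longlongrightarrow> h x s) (at s within {0..1})"
  proof (cases "s = 0")
    case False
    then have s0: "0 < s"
      using s by simp
    have "((\<lambda>s. exp (ln x * (A s / s - 1))) \<longlongrightarrow> exp (ln x * (A s / s - 1))) (at s within {0..1})"
      using A_continuous s s0 by (intro tendsto_intros) (auto simp: continuous_on_def)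
    moreover have "\<forall>\<^sub>F u in at s within {0..1}. 0 < u"
      by (rule order_tendstoD(1)[OF tendsto_ident_at s0])
    then have "\<forall>\<^sub>F u in at s within {0..1}. exp (ln x * (A u / u - 1)) = h x u"
      using eventually_at_topological
      by (smt (verit, del_insts) A_ext_eq eventually_at_filter eventually_mono h_def)
    ultimately show ?thesis
      using s s0 by (simp add: Lim_transform_eventually h_def A_ext_eq)
  next
    case True
    \<comment> \<open>\<open>A u \<ge> 1 - u\<close> bounds \<open>A u / u - 1\<close> below by
      \<open>1 / u - 2\<close>, and the negative factor \<open>ln x\<close> turns this into an upper
      bound for \<open>h x u\<close> that tends to 0.\<close>
    have "filterlim (\<lambda>u::real. 1 / u - 2) at_top (at_right 0)"
      by real_asymp
    then have "filterlim (\<lambda>u. ln x * (1 / u - 2)) at_bot (at_right 0)"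
      using x by (intro filterlim_tendsto_neg_mult_at_bot[OF tendsto_const]) auto
    then have lim: "((\<lambda>u. exp (ln x * (1 / u - 2))) \<longlongrightarrow> 0) (at 0 within {0..1})"
      by (simp add: at_within_Icc_at_right filterlim_compose[OF exp_at_bot])
    have bound: "h x u \<le> exp (ln x * (1 / u - 2))" if "u \<in> {0..1}" for u
    proof (cases "0 < u")
      case True
      have "1 / u - 2 \<le> A_ext u / u - 1"
        using divide_right_mono[OF A_ge(1)[OF that], of u] True
        by (simp add: A_ext_eq[OF that] diff_divide_distrib)
      then show ?thesis
        using True x by (simp add: h_def mult_left_mono_neg)
    qed (simp add: h_def)
    have "(h x \<longlongrightarrow> 0) (at 0 within {0..1})"
      by (rule tendsto_sandwich[OF _ _ tendsto_const lim])
         (use bound in \<open>auto simp: h_nonneg eventually_at_filter\<close>)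
    then show ?thesis
      using True by (simp add: h_def)
  qed
qed

text \<open>\<open>h x\<close> vanishes at 0, so it is the distribution function of the Lebesgue
  density \<open>h' x\<close>. Because of the divisor \<open>s\<^sup>2\<close>, bounds on this
  density are supplied only on intervals \<open>{c..d}\<close> with \<open>0 < c\<close>.\<close>

lemma nn_integral_h':
  assumes x: "x \<in> {0<..<1}" and s: "s \<in> {0<..1}"
  shows "(\<integral>\<^sup>+u\<in>{0<..<s}. ennreal (h' x u) \<partial>lborel) = ennreal (h x s)"
proof -
  have "(\<integral>\<^sup>+u\<in>{0<..<s}. ennreal (h' x u) \<partial>lborel) = ennreal (h x s - h x 0)"
  proof (rule nn_integral_FTC_off_countable[OF _ _ countable_J])
    show "0 < s"
      using s by simp
    show "continuous_on {0..s} (h x)"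
      by (rule continuous_on_subset[OF h_continuous[OF x]]) (use s in auto)
    show "h' x \<in> borel_measurable borel"
      by simp
    show "0 \<le> h' x u" if "u \<in> {0<..<s}" for u
      using that s by (intro h'_nonneg[OF x]) auto
    show "\<exists>B. \<forall>u\<in>{c..d}. h' x u \<le> B" if "0 < c" "d < s" for c d
    proof (intro exI ballI)
      fix u assume u: "u \<in> {c..d}"
      then have u01: "u \<in> {0..1}"
        using that s by auto
      have "h x u * (- ln x) / u\<^sup>2 \<le> 1 * (- ln x) / c\<^sup>2"
        using h_le_1[OF x u01] h_nonneg[of x u] x u that
        by (intro frac_le mult_mono power_mono) auto
      then show "h' x u \<le> 1 * (- ln x) / c\<^sup>2 * 2"
        unfolding h'_def using h_slope_bounds[OF u01] x that
        by (intro mult_mono) (auto intro!: divide_nonpos_nonneg)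
    qed
    fix u assume u: "u \<in> {0<..<s} - J"
    then have u01: "u \<in> {0<..<1}"
      using s by auto
    show "(h x has_real_derivative h' x u) (at u)"
    proof (rule has_field_derivative_transform_within_open[where S = "{0<..<1}"])
      show "((\<lambda>s. exp (ln x * (A s / s - 1))) has_real_derivative h' x u) (at u)"
        using A_deriv[OF u01] u A_ext_eq[of u] u01
        by (auto intro!: derivative_eq_intros simp: h'_def h_def field_simps power2_eq_square)
    qed (use u01 in \<open>auto simp: h_def A_ext_eq\<close>)
    have "isCont (\<lambda>s. exp (ln x * (A s / s - 1)) * (- ln x) / s\<^sup>2 * (A s - s * (2 * \<Theta> s - 1))) u"
      using A_cont[OF u01] u by (intro continuous_intros) (auto simp: J_def)
    moreover have "\<forall>\<^sub>F s in nhds u. s \<in> {0<..<1}"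
      using u01 by (intro eventually_nhds_in_open) auto
    then have "\<forall>\<^sub>F s in nhds u. exp (ln x * (A s / s - 1)) * (- ln x) / s\<^sup>2 * (A s - s * (2 * \<Theta> s - 1)) = h' x s"
      by eventually_elim (simp add: h'_def h_def A_ext_eq)
    ultimately show "isCont (h' x) u"
      by (simp add: isCont_cong)
  qed
  then show ?thesis
    by (simp add: h_def)
qed

end

section \<open>The Markov kernel\<close>

text \<open>Negligibility refers to the completed measure; the Borel assumption on the image brings
  the conclusion back to \<open>lborel\<close>.\<close>

lemma null_sets_lborel_differentiable_image:
  fixes f :: "real \<Rightarrow> real"
  assumes "E \<in> null_sets lborel" "f differentiable_on E" "f ` E \<in> sets borel"
  shows "f ` E \<in> null_sets lborel"
proof -
  have "negligible E"
    using assms(1) by (simp add: negligible_iff_null_sets null_sets_completionI)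
  then have "negligible (f ` E)"
    by (rule negligible_differentiable_image_negligible[OF order.refl _ assms(2)])
  then have "emeasure (completion lborel) (f ` E) = 0"
    by (auto simp: negligible_iff_null_sets)
  then show ?thesis
    using assms(3) by (intro null_setsI) auto
qed

text \<open>For fixed \<open>x\<close>, these are the substitution \<open>t = ln x / ln (x y)\<close> and its inverse.\<close>

definition angle :: "real \<Rightarrow> real \<Rightarrow> real" where
  "angle x y = ln x / (ln x + ln y)"

definition ray :: "real \<Rightarrow> real \<Rightarrow> real" where
  "ray x t = exp (ln x * ((1 - t) / t))"

lemma angle_measurable [measurable]: "(\<lambda>p. angle (fst p) (snd p)) \<in> borel_measurable (borel \<Otimes>\<^sub>M borel)"
  unfolding angle_def by measurable

lemma angle_measurable' [measurable]: "angle x \<in> borel_measurable borel" "(\<lambda>x. angle x y) \<in> borel_measurable borel"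
  unfolding angle_def[abs_def] by measurable

lemma ray_measurable [measurable]: "ray x \<in> borel_measurable borel"
  unfolding ray_def[abs_def] by measurable

lemma angle_in:
  assumes "x \<in> {0<..<1}" "y \<in> {0<..<1}"
  shows "angle x y \<in> {0<..<1}"
proof -
  have "ln x < 0" "ln y < 0"
    using assms by auto
  then show ?thesis
    by (auto simp: angle_def divide_neg_neg divide_less_eq)
qed

lemma ray_in:
  assumes "x \<in> {0<..<1}" "t \<in> {0<..<1}"
  shows "ray x t \<in> {0<..<1}"
proof -
  have "ln x < 0"
    using assms by auto
  then have "ln x * ((1 - t) / t) < 0"
    using assms by (intro mult_neg_pos) auto
  then show ?thesis
    by (simp add: ray_def)
qed

lemma angle_ray:
  assumes "x \<in> {0<..<1}" "t \<in> {0<..<1}"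
  shows "angle x (ray x t) = t"
proof -
  have "ln x + ln x * ((1 - t) / t) = ln x / t" "ln x \<noteq> 0"
    using assms by (auto simp: field_simps)
  then show ?thesis
    using assms by (simp add: angle_def ray_def)
qed

lemma ray_angle:
  assumes "x \<in> {0<..<1}" "y \<in> {0<..<1}"
  shows "ray x (angle x y) = y"
proof -
  have "ln x < 0" "ln y < 0"
    using assms by auto
  then have nz: "ln x + ln y \<noteq> 0" "ln x \<noteq> 0"
    by linarith+
  then have "1 - angle x y = ln y / (ln x + ln y)"
    by (simp add: angle_def diff_divide_eq_iff)
  then have "ln x * ((1 - angle x y) / angle x y) = ln y"
    using nz by (simp add: angle_def)
  then show ?thesis
    using assms by (simp add: ray_def)
qed

text \<open>For fixed \<open>x\<close> the angle increases with \<open>y\<close>. This turns the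
  points up to \<open>y\<close> into an interval of angles, so distribution functions can be
  compared without a change of variables formula.\<close>

lemma ray_le_iff:
  assumes "x \<in> {0<..<1}" "t \<in> {0<..<1}" "y \<in> {0<..<1}"
  shows "ray x t \<le> y \<longleftrightarrow> t \<le> angle x y"
proof -
  have neg: "ln x < 0" "ln y < 0"
    using assms by auto
  have "ray x t \<le> y \<longleftrightarrow> ln x * ((1 - t) / t) \<le> ln y"
    using assms by (simp add: ray_def ln_ge_iff)
  also have "\<dots> \<longleftrightarrow> ln x * (1 - t) \<le> ln y * t"
    using assms by (simp add: field_simps)
  also have "\<dots> \<longleftrightarrow> ln x \<le> t * (ln x + ln y)"
    by (simp add: algebra_simps)
  also have "\<dots> \<longleftrightarrow> t \<le> angle x y"
    using neg by (simp add: angle_def le_divide_eq)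
  finally show ?thesis .
qed

text \<open>The preimage under \<open>ray x\<close> is an image under its inverse
  \<open>angle x\<close>, which is differentiable on the open interval and so keeps sets
  null.\<close>

lemma ray_vimage_null:
  assumes x: "x \<in> {0<..<1}" and E: "E \<in> null_sets lborel"
  shows "{t \<in> {0<..<1}. ray x t \<in> E} \<in> null_sets lborel"
proof -
  have eq: "angle x ` (E \<inter> {0<..<1}) = {t \<in> {0<..<1}. ray x t \<in> E}"
  proof (intro equalityI subsetI)
    fix t assume "t \<in> {t \<in> {0<..<1}. ray x t \<in> E}"
    then show "t \<in> angle x ` (E \<inter> {0<..<1})"
      using angle_ray[OF x] ray_in[OF x] by (intro image_eqI[of _ _ "ray x t"]) auto
  qed (use angle_in[OF x] ray_angle[OF x] in auto)
  have [measurable]: "E \<in> sets borel"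
    using E by auto
  have "{t \<in> {0<..<1}. ray x t \<in> E} \<in> sets borel"
    by measurable
  moreover have "E \<inter> {0<..<1} \<in> null_sets lborel"
    using E by (auto intro: null_set_Int2)
  moreover have "angle x differentiable_on (E \<inter> {0<..<1})"
  proof -
    have "angle x differentiable (at y)" if "y \<in> {0<..<1}" for y
    proof -
      have "ln x < 0" "ln y < 0"
        using x that by auto
      then have "ln x + ln y \<noteq> 0"
        by linarith
      then have "((\<lambda>y. ln x / (ln x + ln y)) has_real_derivative - (ln x * (1 / y)) / (ln x + ln y)\<^sup>2) (at y)"
        using that by (auto intro!: derivative_eq_intros simp: power2_eq_square)
      then show ?thesis
        unfolding angle_def[abs_def] using real_differentiable_def by blast
    qed
    then show ?thesis
      by (auto simp: differentiable_on_def intro: differentiable_at_withinI)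
  qed
  ultimately show ?thesis
    using null_sets_lborel_differentiable_image[of "E \<inter> {0<..<1}" "angle x"] by (simp add: eq)
qed

lemma angle_vimage_null:
  assumes x: "x \<in> {0<..<1}" and N: "N \<in> null_sets lborel" "N \<subseteq> {0<..<1}"
  shows "{y \<in> {0<..<1}. angle x y \<in> N} \<in> null_sets lborel"
proof -
  have eq: "ray x ` N = {y \<in> {0<..<1}. angle x y \<in> N}"
  proof (intro equalityI subsetI)
    fix y assume "y \<in> {y \<in> {0<..<1}. angle x y \<in> N}"
    then show "y \<in> ray x ` N"
      using ray_angle[OF x] by (intro image_eqI[of _ _ "angle x y"]) auto
  next
    fix y assume "y \<in> ray x ` N"
    then obtain t where "t \<in> N" "y = ray x t" "t \<in> {0<..<1}"
      using N by auto
    then show "y \<in> {y \<in> {0<..<1}. angle x y \<in> N}"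
      using ray_in[OF x, of t] angle_ray[OF x, of t] by simp
  qed
  have [measurable]: "N \<in> sets borel"
    using N by auto
  have "{y \<in> {0<..<1}. angle x y \<in> N} \<in> sets borel"
    by measurable
  moreover have "ray x differentiable_on N"
  proof -
    have "ray x differentiable (at t)" if "t \<in> {0<..<1}" for t
    proof -
      have "((\<lambda>t. exp (ln x * ((1 - t) / t))) has_real_derivative
          exp (ln x * ((1 - t) / t)) * (ln x * ((- 1 * t - (1 - t) * 1) / (t * t)))) (at t)"
        using that by (auto intro!: derivative_eq_intros simp: right_diff_distrib)
      then show ?thesis
        unfolding ray_def[abs_def] using real_differentiable_def by blast
    qed
    then show ?thesis
      unfolding differentiable_on_def using N(2) by (blast intro: differentiable_at_withinI)
  qed
  ultimately show ?thesis
    using null_sets_lborel_differentiable_image[of N "ray x"] N by (simp add: eq)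
qed

text \<open>The union of the curves \<open>y = ray x t\<close> with \<open>t\<close> in
  \<open>S\<close>. A Borel null set of angles in the open interval thus becomes one measurable set
  of the square all of whose sections are null, and it serves every \<open>x\<close>.\<close>

definition sector :: "real set \<Rightarrow> (real \<times> real) set" where
  "sector S = {(x, y). x \<in> {0<..<1} \<and> y \<in> {0<..<1} \<and> angle x y \<in> S}"

lemma Pair_vimage_sector:
  "Pair x -` sector S = (if x \<in> {0<..<1} then {y \<in> {0<..<1}. angle x y \<in> S} else {})"
  by (auto simp: sector_def)

lemma sector_sets:
  assumes [measurable]: "S \<in> sets borel"
  shows "sector S \<in> sets (unit_leb \<Otimes>\<^sub>M unit_leb)"
proof -
  have f: "fst \<in> borel_measurable (unit_leb \<Otimes>\<^sub>M unit_leb)" "snd \<in> borel_measurable (unit_leb \<Otimes>\<^sub>M unit_leb)"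
    by (rule measurable_compose[OF measurable_fst] measurable_compose[OF measurable_snd],
        rule measurable_restrict_space1, simp)+
  have [measurable]: "(\<lambda>p. (fst p, snd p)) \<in> (unit_leb \<Otimes>\<^sub>M unit_leb) \<rightarrow>\<^sub>M (borel \<Otimes>\<^sub>M borel :: (real \<times> real) measure)"
    by (rule measurable_Pair[OF f])
  have [measurable]: "{p. 0 < fst p \<and> fst p < 1 \<and> 0 < snd p \<and> snd p < 1 \<and> angle (fst p) (snd p) \<in> S}
      \<in> sets (borel \<Otimes>\<^sub>M borel :: (real \<times> real) measure)" (is "?B \<in> _")
  proof -
    have "{p \<in> space (borel \<Otimes>\<^sub>M borel). 0 < fst p \<and> fst p < 1 \<and> 0 < snd p \<and> snd p < 1 \<and> angle (fst p) (snd p) \<in> S}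
        \<in> sets (borel \<Otimes>\<^sub>M borel :: (real \<times> real) measure)"
      by measurable
    then show ?thesis
      by (simp add: space_pair_measure)
  qed
  have "(\<lambda>p. (fst p, snd p)) -` ?B \<inter> space (unit_leb \<Otimes>\<^sub>M unit_leb) \<in> sets (unit_leb \<Otimes>\<^sub>M unit_leb)"
    by measurable
  also have "(\<lambda>p. (fst p, snd p)) -` ?B \<inter> space (unit_leb \<Otimes>\<^sub>M unit_leb) = sector S"
    by (auto simp: sector_def space_pair_measure space_unit_leb)
  finally show ?thesis .
qed

section \<open>The kernel in the angle and its transport to \<open>y\<close>\<close>

context pickands
begin

definition w :: "real \<Rightarrow> real \<Rightarrow> real" where
  "w x s = (if 0 < s \<and> s < 1 then 2 * (1 - s) * h x s else 0)"

definition v :: "real \<Rightarrow> real \<Rightarrow> real" where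
  "v x u = (if 0 < u \<and> u < 1 then h' x u * G u else 0)"

lemma w_v_measurable [measurable]: "w x \<in> borel_measurable borel" "v x \<in> borel_measurable borel"
  unfolding w_def[abs_def] v_def[abs_def] by measurable

text \<open>At the end points the cut-off changes no value: \<open>h\<close> vanishes at 0 and
  \<open>1 - s\<close> at 1. Positivity in between is what keeps the discrete and singular mass of
  \<theta>.\<close>

lemma w_pos_iff: "0 < w x s \<longleftrightarrow> s \<in> {0<..<1}"
  by (auto simp: w_def h_pos zero_less_mult_iff)

text \<open>The product rule for \<open>h G\<close>: the density against \<open>\<tau>\<close> is \<open>h\<close> times that of \<open>dG\<close>, and the
  absolutely continuous rest has Lebesgue density \<open>h' G\<close>.\<close>

definition \<mu> :: "real \<Rightarrow> real measure" where
  "\<mu> x = sum_measure (density \<tau> (\<lambda>s. ennreal (w x s))) (density lborel (\<lambda>u. ennreal (v x u)))"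

lemma sets_\<mu> [simp, measurable_cong]: "sets (\<mu> x) = sets borel"
  by (simp add: \<mu>_def)

lemma emeasure_\<mu>:
  assumes "E \<in> sets borel"
  shows "emeasure (\<mu> x) E = (\<integral>\<^sup>+s\<in>E. ennreal (w x s) \<partial>\<tau>) + (\<integral>\<^sup>+u\<in>E. ennreal (v x u) \<partial>lborel)"
  using assms by (simp add: \<mu>_def emeasure_sum_measure emeasure_density)

lemma emeasure_\<mu>_cong:
  assumes "E \<in> sets borel" "F \<in> sets borel" "E \<inter> {0<..<1} = F \<inter> {0<..<1}"
  shows "emeasure (\<mu> x) E = emeasure (\<mu> x) F"
proof -
  have "s \<in> E \<longleftrightarrow> s \<in> F" if "0 < s" "s < 1" for s
  proof -
    have "s \<in> E \<inter> {0<..<1} \<longleftrightarrow> s \<in> F \<inter> {0<..<1}"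
      by (simp only: assms(3))
    then show ?thesis
      using that by simp
  qed
  then have "ennreal (w x s) * indicator E s = ennreal (w x s) * indicator F s"
    "ennreal (v x s) * indicator E s = ennreal (v x s) * indicator F s" for s
    by (simp_all add: w_def v_def indicator_def)
  then show ?thesis
    by (simp only: emeasure_\<mu>[OF assms(1)] emeasure_\<mu>[OF assms(2)])
qed

lemma \<mu>_atMost:
  assumes x: "x \<in> {0<..<1}" and t: "t \<in> {0<..1}"
  shows "emeasure (\<mu> x) {..t} = ennreal (h x t * G t)"
proof -
  \<comment> \<open>\<open>G\<close> is the distribution function of \<open>f\<close> against
    \<tau>, and \<open>h x\<close> that of \<open>g\<close> against Lebesgue measure. The two
    densities in \<open>\<mu> x\<close> are \<open>f\<close> times \<open>h x\<close> and
    \<open>g\<close> times \<open>G\<close>, so the mass of \<open>{..t}\<close> is the left side of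
    \<open>nn_integral_cdf_mult\<close>.\<close>
  define f where "f s = ennreal (2 * (1 - s))" for s :: real
  define g where "g u = ennreal (h' x u) * indicator {0<..<1} u" for u
  have [measurable]: "f \<in> borel_measurable borel" "g \<in> borel_measurable borel"
    unfolding f_def g_def by measurable
  have g: "(\<integral>\<^sup>+u\<in>{..<s}. g u \<partial>lborel) = ennreal (h x s)" if "s \<le> 1" for s
  proof (cases "0 < s")
    case True
    have "(\<integral>\<^sup>+u\<in>{..<s}. g u \<partial>lborel) = (\<integral>\<^sup>+u\<in>{0<..<s}. ennreal (h' x u) \<partial>lborel)"
      using that by (intro nn_integral_cong) (auto simp: g_def indicator_def)
    then show ?thesis
      using nn_integral_h'[OF x, of s] True that by simp
  next
    case False
    then have "(\<integral>\<^sup>+u\<in>{..<s}. g u \<partial>lborel) = (\<integral>\<^sup>+u. 0 \<partial>(lborel :: real measure))"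
      by (intro nn_integral_cong) (auto simp: g_def indicator_def)
    then show ?thesis
      using False by (simp add: h_def)
  qed
  have f: "(\<integral>\<^sup>+s\<in>{..u}. f s \<partial>\<tau>) = ennreal (G u)" if "u \<in> {0..1}" for u
    unfolding f_def by (rule nn_integral_\<tau>_atMost[OF that])
  have "emeasure (\<mu> x) {..t} = (\<integral>\<^sup>+s. f s * indicator {..t} s * (\<integral>\<^sup>+u\<in>{..<s}. g u \<partial>lborel) \<partial>\<tau>) +
      (\<integral>\<^sup>+u. g u * indicator {..t} u * (\<integral>\<^sup>+s\<in>{..u}. f s \<partial>\<tau>) \<partial>lborel)"
  proof -
    have "ennreal (w x s) * indicator {..t} s = f s * indicator {..t} s * (\<integral>\<^sup>+u\<in>{..<s}. g u \<partial>lborel)" for s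
    proof (cases "s \<le> t")
      case True
      then have s: "s \<le> 1"
        using t by simp
      have "ennreal (w x s) = f s * ennreal (h x s)"
        using s by (cases "0 < s \<and> s < 1") (auto simp: w_def f_def h_def ennreal_mult)
      then show ?thesis
        using True by (simp add: g[OF s])
    qed simp
    moreover have "ennreal (v x u) * indicator {..t} u = g u * indicator {..t} u * (\<integral>\<^sup>+s\<in>{..u}. f s \<partial>\<tau>)" for u
    proof (cases "u \<in> {0<..<1}")
      case True
      then have u: "u \<in> {0..1}"
        by simp
      have "ennreal (v x u) = g u * ennreal (G u)"
        using True h'_nonneg[OF x u] G_nonneg[OF u] by (simp add: v_def g_def ennreal_mult)
      then show ?thesis
        by (simp add: f[OF u] mult_ac)
    next
      case False
      then show ?thesis
        by (auto simp: v_def g_def)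
    qed
    ultimately show ?thesis
      by (simp add: emeasure_\<mu>)
  qed
  also have "\<dots> = (\<integral>\<^sup>+s\<in>{..t}. f s \<partial>\<tau>) * (\<integral>\<^sup>+u\<in>{..t}. g u \<partial>lborel)"
    by (rule nn_integral_cdf_mult) (simp_all add: \<tau>.sigma_finite_measure_axioms lborel.sigma_finite_measure_axioms)
  \<comment> \<open>Whether the half-line contains \<open>t\<close> matters for \<tau>, which may
    have an atom there, but not for Lebesgue measure.\<close>
  also have "(\<integral>\<^sup>+u\<in>{..t}. g u \<partial>lborel) = (\<integral>\<^sup>+u\<in>{..<t}. g u \<partial>lborel)"
    by (intro nn_integral_cong_AE) (use AE_lborel_singleton[of t] in eventually_elim, auto simp: indicator_def)
  also have "\<dots> = ennreal (h x t)"
    using t by (intro g) simp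
  also have "(\<integral>\<^sup>+s\<in>{..t}. f s \<partial>\<tau>) = ennreal (G t)"
    using t by (intro f) simp
  also have "ennreal (G t) * ennreal (h x t) = ennreal (h x t * G t)"
    using t G_nonneg[of t] h_nonneg[of x t] by (simp add: ennreal_mult mult.commute)
  finally show ?thesis .
qed

lemma \<mu>_prob:
  assumes x: "x \<in> {0<..<1}"
  shows "emeasure (\<mu> x) UNIV = 1"
proof -
  have "emeasure (\<mu> x) UNIV = emeasure (\<mu> x) {..1}"
    by (rule emeasure_\<mu>_cong) auto
  then show ?thesis
    using \<mu>_atMost[OF x, of 1] by (simp add: h_1 G_1)
qed

text \<open>On a Lebesgue null set only the summand with density \<open>w x\<close> against \<tau>
  is left, and this density is positive exactly on the open interval. The resulting condition does
  not depend on \<open>x\<close>.\<close>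

lemma \<mu>_null_iff:
  assumes E: "E \<in> null_sets lborel"
  shows "emeasure (\<mu> x) E = 0 \<longleftrightarrow> emeasure \<tau> (E \<inter> {0<..<1}) = 0"
proof -
  have [measurable]: "E \<in> sets borel"
    using E by auto
  have "(\<integral>\<^sup>+u\<in>E. ennreal (v x u) \<partial>lborel) = 0"
    by (intro nn_integral_null_set E)
  then have "emeasure (\<mu> x) E = 0 \<longleftrightarrow> (\<integral>\<^sup>+s\<in>E. ennreal (w x s) \<partial>\<tau>) = 0"
    by (simp add: emeasure_\<mu>)
  also have "\<dots> \<longleftrightarrow> (AE s in \<tau>. ennreal (w x s) * indicator E s = 0)"
    by (subst nn_integral_0_iff_AE) auto
  also have "\<dots> \<longleftrightarrow> (AE s in \<tau>. s \<notin> E \<inter> {0<..<1})"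
  proof (rule AE_cong)
    fix s
    show "ennreal (w x s) * indicator E s = 0 \<longleftrightarrow> s \<notin> E \<inter> {0<..<1}"
      using w_pos_iff[of x s] by (auto simp: indicator_def ennreal_eq_0_iff not_le)
  qed
  also have "\<dots> \<longleftrightarrow> E \<inter> {0<..<1} \<in> null_sets \<tau>"
    by (rule AE_iff_null_sets[symmetric]) simp
  finally show ?thesis
    by (auto simp: null_sets_def)
qed

text \<open>Both defaults are harmless: \<open>\<mu> x\<close> has no mass at angles outside the
  open interval, and in the unit interval only the first arguments 0 and 1 are affected. They make
  every \<open>K x\<close> a probability measure on the unit interval.\<close>

definition K :: "real \<Rightarrow> real measure" where
  "K x = (if x \<in> {0<..<1}
     then distr (\<mu> x) unit_leb (\<lambda>t. if t \<in> {0<..<1} then ray x t else 0) else unit_leb)"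

lemma ray_clip_measurable:
  assumes "x \<in> {0<..<1}"
  shows "(\<lambda>t. if t \<in> {0<..<1} then ray x t else 0) \<in> \<mu> x \<rightarrow>\<^sub>M unit_leb"
proof (rule measurable_restrict_space2)
  show "(\<lambda>t. if t \<in> {0<..<1} then ray x t else 0) \<in> space (\<mu> x) \<rightarrow> {0..1}"
  proof
    fix t
    show "(if t \<in> {0<..<1} then ray x t else 0) \<in> {0..1}"
      using ray_in[OF assms, of t] by auto
  qed
  show "(\<lambda>t. if t \<in> {0<..<1} then ray x t else 0) \<in> \<mu> x \<rightarrow>\<^sub>M lborel"
    by measurable
qed

lemma sets_K: "sets (K x) = sets unit_leb"
  by (simp add: K_def)

lemma emeasure_K:
  assumes x: "x \<in> {0<..<1}" and F: "F \<in> sets unit_leb"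
  shows "emeasure (K x) F = emeasure (\<mu> x) {t \<in> {0<..<1}. ray x t \<in> F}"
proof -
  have [measurable]: "F \<in> sets borel"
    using F by (simp add: sets_unit_leb_iff)
  have sp: "space (\<mu> x) = UNIV"
    using sets_eq_imp_space_eq[OF sets_\<mu>] by simp
  have "emeasure (K x) F = emeasure (\<mu> x) ((\<lambda>t. if t \<in> {0<..<1} then ray x t else 0) -` F \<inter> space (\<mu> x))"
    unfolding K_def by (simp only: x if_True emeasure_distr[OF ray_clip_measurable[OF x] F])
  also have "\<dots> = emeasure (\<mu> x) {t \<in> {0<..<1}. ray x t \<in> F}"
  proof (rule emeasure_\<mu>_cong)
    show "(\<lambda>t. if t \<in> {0<..<1} then ray x t else 0) -` F \<inter> space (\<mu> x) \<in> sets borel"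
      using measurable_sets[OF ray_clip_measurable[OF x] F] by simp
  qed (auto simp: sp)
  finally show ?thesis .
qed

lemma prob_K: "prob_space (K x)"
proof (cases "x \<in> {0<..<1}")
  case True
  have "space (\<mu> x) = UNIV"
    using sets_eq_imp_space_eq[OF sets_\<mu>] by simp
  then have "prob_space (\<mu> x)"
    by (intro prob_spaceI) (simp add: \<mu>_prob[OF True])
  then show ?thesis
    unfolding K_def using prob_space.prob_space_distr[OF _ ray_clip_measurable[OF True]]
    by (simp only: True if_True)
next
  case False
  then show ?thesis
    unfolding K_def by (simp only: if_False prob_space_unit_leb)
qed

lemma K_0:
  assumes x: "x \<in> {0<..<1}"
  shows "emeasure (K x) {0..0} = 0"
proof -
  have "{t \<in> {0<..<1}. ray x t \<in> {0..0}} = {}"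
    using ray_in[OF x] by force
  moreover have "emeasure (K x) {0..0} = emeasure (\<mu> x) {t \<in> {0<..<1}. ray x t \<in> {0..0}}"
    by (rule emeasure_K[OF x]) (simp add: sets_unit_leb_iff)
  ultimately show ?thesis
    by (simp only: emeasure_empty)
qed

lemma K_atMost:
  assumes x: "x \<in> {0<..<1}" and y: "y \<in> {0<..<1}"
  shows "emeasure (K x) {0..y} = ennreal (h x (angle x y) * G (angle x y))"
proof -
  have "{t \<in> {0<..<1}. ray x t \<in> {0..y}} = {t \<in> {0<..<1}. t \<le> angle x y}"
    using ray_le_iff[OF x _ y] ray_in[OF x] by force
  then have "emeasure (K x) {0..y} = emeasure (\<mu> x) {t \<in> {0<..<1}. t \<le> angle x y}"
    using y by (subst emeasure_K[OF x]) (auto simp: sets_unit_leb_iff)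
  also have "\<dots> = emeasure (\<mu> x) {..angle x y}"
    by (rule emeasure_\<mu>_cong) auto
  also have "\<dots> = ennreal (h x (angle x y) * G (angle x y))"
    by (rule \<mu>_atMost[OF x]) (use angle_in[OF x y] in auto)
  finally show ?thesis .
qed

lemma K_1: "emeasure (K x) {0..1} = 1"
proof -
  interpret prob_space "K x"
    by (rule prob_K)
  have "space (K x) = {0..1}"
    using sets_eq_imp_space_eq[OF sets_K] by (simp add: space_unit_leb)
  then show ?thesis
    using emeasure_space_1 by simp
qed

text \<open>On the generator it suffices that the mass of \<open>{0..q}\<close> depends measurably
  on \<open>x\<close>, and \<open>K_atMost\<close> gives it explicitly. That formula requires
  \<open>q\<close> in the open interval, so 0 and 1 are treated apart.\<close>

lemma K_measurable: "K \<in> unit_leb \<rightarrow>\<^sub>M prob_algebra unit_leb"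
proof (rule measurable_prob_algebraI)
  show "prob_space (K x)" for x
    by (rule prob_K)
  show "K \<in> unit_leb \<rightarrow>\<^sub>M subprob_algebra unit_leb"
  proof (rule measurable_subprob_algebra_generated[OF sets_unit_leb_eq Int_stable_rat_intervals rat_intervals_subset])
    show "subprob_space (K x)" for x
      by (intro prob_space_imp_subprob_space prob_K)
    show "sets (K x) = sets unit_leb" for x
      by (rule sets_K)
    show "(\<lambda>x. emeasure (K x) {0..1}) \<in> borel_measurable unit_leb"
      by (simp add: K_1)
    fix F assume "F \<in> rat_intervals"
    then obtain q where q: "F = {0..q}" "0 \<le> q" "q \<le> 1"
      by (auto simp: rat_intervals_def)
    consider "q = 0" | "q = 1" | "q \<in> {0<..<1}"
      using q by force
    then show "(\<lambda>x. emeasure (K x) F) \<in> borel_measurable unit_leb"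
    proof cases
      case 1
      have "emeasure (K x) F = 0" for x
      proof (cases "x \<in> {0<..<1}")
        case True
        then show ?thesis
          using K_0 q 1 by simp
      next
        case False
        then have "K x = unit_leb"
          by (auto simp: K_def)
        then show ?thesis
          using q 1 by (simp add: emeasure_restrict_space)
      qed
      then show ?thesis
        by simp
    next
      case 2
      then show ?thesis
        using q by (simp add: K_1)
    next
      case 3
      have "emeasure (K x) F = (if x \<in> {0<..<1} then ennreal (h x (angle x q) * G (angle x q)) else ennreal q)" for x
      proof (cases "x \<in> {0<..<1}")
        case True
        then show ?thesis
          using K_atMost[OF True 3] q by simp
      next
        case False
        then have "K x = unit_leb"
          by (auto simp: K_def)
        then have "emeasure (K x) F = ennreal q"
          using q by (simp add: emeasure_restrict_space)
        then show ?thesis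
          by (simp only: False if_False)
      qed
      moreover have [measurable]: "(\<lambda>x. h x (angle x q)) \<in> borel_measurable borel"
      proof -
        have "(\<lambda>x. (x, angle x q)) \<in> borel \<rightarrow>\<^sub>M borel \<Otimes>\<^sub>M borel"
          by measurable
        from measurable_compose[OF this h_measurable] show ?thesis
          by simp
      qed
      have "(\<lambda>x. if x \<in> {0<..<1} then ennreal (h x (angle x q) * G (angle x q)) else ennreal q) \<in> borel_measurable lborel"
        by measurable
      ultimately show ?thesis
        by (simp add: measurable_restrict_space1)
    qed
  qed
qed

lemma K_sector:
  assumes x: "x \<in> {0<..<1}" and S: "S \<in> sets borel" "S \<subseteq> {0<..<1}"
  shows "emeasure (K x) (Pair x -` sector S) = emeasure (\<mu> x) S"
proof -
  have "Pair x -` sector S \<in> sets unit_leb"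
    by (rule sets_Pair1[OF sector_sets[OF S(1)]])
  then have "emeasure (K x) (Pair x -` sector S) = emeasure (\<mu> x) {t \<in> {0<..<1}. ray x t \<in> Pair x -` sector S}"
    by (rule emeasure_K[OF x])
  also have "{t \<in> {0<..<1}. ray x t \<in> Pair x -` sector S} = S"
    using x S angle_ray[OF x] ray_in[OF x] by (auto simp: Pair_vimage_sector)
  finally show ?thesis .
qed

text \<open>\<open>ray x\<close> and \<open>angle x\<close> are inverse bijections of the open
  interval that preserve countable and null sets, and \<open>K x\<close> vanishes on a null set
  exactly when \<tau> vanishes on its angles. So the carriers \<open>D\<close> and \<open>N\<close>
  for \<tau> pass to sections of sectors that decompose \<open>K x\<close>.\<close>

lemma K_parts:
  assumes x: "x \<in> {0<..<1}" and D: "countable D" "D \<subseteq> N" and N: "N \<in> null_sets lborel" "N \<subseteq> {0<..<1}"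
    and atoms: "\<And>t. t \<in> {0<..<1} - D \<Longrightarrow> emeasure \<tau> {t} = 0"
    and null: "\<And>E. E \<in> null_sets lborel \<Longrightarrow> E \<subseteq> {0<..<1} - N \<Longrightarrow> emeasure \<tau> E = 0"
  shows "abs_part (K x) = density (K x) (indicator ({0..1} - Pair x -` sector N))"
    "dis_part (K x) = density (K x) (indicator (Pair x -` sector D))"
    "sing_part (K x) = density (K x) (indicator (Pair x -` sector N - Pair x -` sector D))"
proof -
  have Nm: "N \<in> sets borel"
    using N by auto
  have sector: "Pair x -` sector S = {y \<in> {0<..<1}. angle x y \<in> S}" for S
    using x by (simp add: Pair_vimage_sector)
  have cD: "countable (Pair x -` sector D)"
  proof (rule countable_subset)
    show "Pair x -` sector D \<subseteq> ray x ` D"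
      unfolding sector using ray_angle[OF x] by force
    show "countable (ray x ` D)"
      using D by simp
  qed
  have DN: "Pair x -` sector D \<subseteq> Pair x -` sector N"
    using D by (auto simp: sector_def)
  have N0: "Pair x -` sector N \<in> null_sets unit_leb"
    using angle_vimage_null[OF x N] unfolding sector null_sets_unit_leb_iff by auto
  have at: "emeasure (K x) {y} = 0" if y: "y \<in> {0..1} - Pair x -` sector D" for y
  proof -
    let ?E = "{t \<in> {0<..<1}. ray x t \<in> {y}}"
    have "?E \<in> null_sets lborel"
      by (rule ray_vimage_null[OF x]) (simp add: countable_imp_null_set_lborel)
    moreover have "emeasure \<tau> (?E \<inter> {0<..<1}) = 0"
    proof (cases "?E = {}")
      case False
      then obtain t where t: "t \<in> {0<..<1}" "ray x t = y"
        by auto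
      have "u = t" if "u \<in> ?E" for u
        using angle_ray[OF x, of u] angle_ray[OF x, of t] that t by auto
      moreover have "t \<in> ?E"
        using t by simp
      ultimately have "?E = {t}"
        by blast
      moreover have "t \<notin> D"
        using t y ray_in[OF x t(1)] angle_ray[OF x t(1)] by (auto simp: sector)
      ultimately show ?thesis
        using atoms t by auto
    next
      case True
      then show ?thesis
        by (simp only: Int_empty_left emeasure_empty)
    qed
    ultimately have "emeasure (\<mu> x) ?E = 0"
      using \<mu>_null_iff by blast
    then show ?thesis
      using y by (subst emeasure_K[OF x]) (auto simp: sets_unit_leb_iff)
  qed
  have nul: "emeasure (K x) (E - Pair x -` sector N) = 0" if E: "E \<in> null_sets unit_leb" for E
  proof -
    let ?E = "{t \<in> {0<..<1}. ray x t \<in> E - Pair x -` sector N}"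
    have EN: "E - Pair x -` sector N \<in> null_sets unit_leb"
      by (rule null_set_Diff[OF E]) (use N0 in auto)
    then have E0: "?E \<in> null_sets lborel"
      by (intro ray_vimage_null[OF x]) (simp add: null_sets_unit_leb_iff)
    have "?E \<subseteq> {0<..<1} - N"
      using angle_ray[OF x] ray_in[OF x] by (auto simp: sector)
    then have "emeasure \<tau> (?E \<inter> {0<..<1}) = 0"
      using null[OF E0] by (simp add: Int_absorb2 subset_Diff_insert le_infI1 Int_absorb1 inf_absorb1 subset_iff)
    then have "emeasure (\<mu> x) ?E = 0"
      using \<mu>_null_iff[OF E0] by blast
    then show ?thesis
      by (subst emeasure_K[OF x]) (use EN in auto)
  qed
  show "abs_part (K x) = density (K x) (indicator ({0..1} - Pair x -` sector N))"
    "dis_part (K x) = density (K x) (indicator (Pair x -` sector D))"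
    "sing_part (K x) = density (K x) (indicator (Pair x -` sector N - Pair x -` sector D))"
    by (rule lebesgue_decomposition_densityI[OF sets_K cD DN N0 at nul]; assumption)+
qed

lemma AE_unit_leb_interior: "AE x in unit_leb. x \<in> {0<..<1}"
proof -
  have "AE x in lborel. x \<in> {0..1} \<longrightarrow> x \<in> {0<..<1::real}"
    using AE_lborel_singleton[of 0] AE_lborel_singleton[of 1] by eventually_elim auto
  then show ?thesis
    by (subst AE_restrict_space_iff) auto
qed

text \<open>For almost every \<open>x\<close> the section has mass
  \<open>emeasure (\<mu> x) S\<close>, and whether this is 0 depends on \<tau> only. A condition
  free of \<open>x\<close> holds almost everywhere under a probability measure only if it
  holds.\<close>

lemma K_sector_mass_pos_iff:
  assumes S: "S \<in> null_sets lborel" "S \<subseteq> {0<..<1}"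
  shows "(\<integral>\<^sup>+x. emeasure (K x) (Pair x -` sector S) \<partial>unit_leb) > 0 \<longleftrightarrow> emeasure \<tau> S > 0"
proof -
  interpret U: prob_space unit_leb
    by (rule prob_space_unit_leb)
  have Sm: "S \<in> sets borel"
    using S by auto
  have "(\<integral>\<^sup>+x. emeasure (K x) (Pair x -` sector S) \<partial>unit_leb) = 0 \<longleftrightarrow>
      (AE x in unit_leb. emeasure (K x) (Pair x -` sector S) = 0)"
    by (rule nn_integral_0_iff_AE[OF kernel_section_measurable[OF K_measurable sector_sets[OF Sm]]])
  also have "\<dots> \<longleftrightarrow> (AE x in unit_leb. emeasure \<tau> S = 0)"
  proof (rule eventually_subst)
    show "AE x in unit_leb. (emeasure (K x) (Pair x -` sector S) = 0) = (emeasure \<tau> S = 0)"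
      using AE_unit_leb_interior
    proof eventually_elim
      case (elim x)
      show ?case
        unfolding K_sector[OF elim Sm S(2)] using \<mu>_null_iff[OF S(1)] S(2) by (simp add: Int_absorb2)
    qed
  qed
  also have "\<dots> \<longleftrightarrow> emeasure \<tau> S = 0"
    by simp
  finally show ?thesis
    by (simp add: zero_less_iff_neq_zero)
qed

end

section \<open>The copula of a Pickands function\<close>

text \<open>\<open>C\<close> comes from a distribution on the plane, so the margins first appear for
  unbounded strips; uniform margins leave no mass beyond 1, and the strips may be cut there. The
  Pickands formula covers the open square only, so the edges are obtained here.\<close>

lemma copula_margins:
  assumes "copula C"
  shows "x \<in> {0..1} \<Longrightarrow> C x 1 = x" "y \<in> {0..1} \<Longrightarrow> C 1 y = y"
    "y \<in> {0..1} \<Longrightarrow> C 0 y = 0" "x \<in> {0..1} \<Longrightarrow> C x 0 = 0"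
proof -
  from assms obtain M :: "(real \<times> real) measure" where "prob_space M" and s: "sets M = sets borel"
    and d: "distr M borel fst = uniform_measure lborel {0..1}" "distr M borel snd = uniform_measure lborel {0..1}"
    and C: "\<And>x y. x \<in> {0..1} \<Longrightarrow> y \<in> {0..1} \<Longrightarrow> C x y = measure M ({..x} \<times> {..y})"
    unfolding copula_def by blast
  interpret prob_space M by fact
  have sp: "space M = UNIV"
    using sets_eq_imp_space_eq[OF s] by simp
  have box: "A \<times> B \<in> sets M" if "A \<in> sets borel" "B \<in> sets borel" for A B :: "real set"
    using that by (simp add: s borel_Times)
  have [measurable]: "fst \<in> borel_measurable M" "snd \<in> borel_measurable M"
    unfolding measurable_cong_sets[OF s refl]
    by (rule borel_measurable_continuous_onI, rule continuous_on_fst continuous_on_snd, rule continuous_on_id)+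
  have U: "measure (uniform_measure lborel {0..1}) {..x} = x" "measure (uniform_measure lborel {0..1}) {1::real<..} = 0"
    if "x \<in> {0..1}" for x :: real
  proof -
    have "{0..1} \<inter> {..x} = {0..x}" "{0..1} \<inter> {1<..} = ({} :: real set)"
      using that by auto
    note eqs = this
    then show "measure (uniform_measure lborel {0..1}) {..x} = x" "measure (uniform_measure lborel {0..1}) {1::real<..} = 0"
      using that measure_uniform_measure[of lborel "{0..1::real}" "{..x}"]
        measure_uniform_measure[of lborel "{0..1::real}" "{1<..}"]
      unfolding eqs by simp_all
  qed
  have 1: "measure M ({..x} \<times> UNIV) = x" "measure M (UNIV \<times> {..x}) = x"
    "measure M ({1<..} \<times> UNIV) = 0" "measure M (UNIV \<times> {1<..}) = 0" if "x \<in> {0..1}" for x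
  proof -
    have "measure M (fst -` E \<inter> space M) = measure (uniform_measure lborel {0..1}) E"
      "measure M (snd -` E \<inter> space M) = measure (uniform_measure lborel {0..1}) E" if "E \<in> sets borel" for E
      using that by (simp add: measure_distr flip: d(1), simp add: measure_distr flip: d(2))
    moreover have "fst -` E \<inter> space M = E \<times> UNIV" "snd -` E \<inter> space M = UNIV \<times> E" for E
      by (auto simp: sp)
    ultimately have "measure M (E \<times> UNIV) = measure (uniform_measure lborel {0..1}) E"
      "measure M (UNIV \<times> E) = measure (uniform_measure lborel {0..1}) E" if "E \<in> sets borel" for E
      using that by metis+
    then show "measure M ({..x} \<times> UNIV) = x" "measure M (UNIV \<times> {..x}) = x"
      "measure M ({1<..} \<times> UNIV) = 0" "measure M (UNIV \<times> {1<..}) = 0"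
      using U[OF that] by simp_all
  qed
  have top: "measure M ({..x} \<times> {..1}) = x" "measure M ({..1} \<times> {..x}) = x" if x: "x \<in> {0..1}" for x
  proof -
    have "measure M ({..x} \<times> UNIV) \<le> measure M ({..x} \<times> {..1} \<union> UNIV \<times> {1<..})"
      by (intro finite_measure_mono sets.Un box) auto
    also have "\<dots> \<le> measure M ({..x} \<times> {..1}) + measure M (UNIV \<times> {1<..})"
      by (intro measure_Un_le box) auto
    finally have "x \<le> measure M ({..x} \<times> {..1})"
      using 1[OF x] by simp
    moreover have "measure M ({..x} \<times> {..1}) \<le> measure M ({..x} \<times> UNIV)"
      by (intro finite_measure_mono box) auto
    ultimately show "measure M ({..x} \<times> {..1}) = x"
      using 1[OF x] by simp
    have "measure M (UNIV \<times> {..x}) \<le> measure M ({..1} \<times> {..x} \<union> {1<..} \<times> UNIV)"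
      by (intro finite_measure_mono sets.Un box) auto
    also have "\<dots> \<le> measure M ({..1} \<times> {..x}) + measure M ({1<..} \<times> UNIV)"
      by (intro measure_Un_le box) auto
    finally have "x \<le> measure M ({..1} \<times> {..x})"
      using 1[OF x] by simp
    moreover have "measure M ({..1} \<times> {..x}) \<le> measure M (UNIV \<times> {..x})"
      by (intro finite_measure_mono box) auto
    ultimately show "measure M ({..1} \<times> {..x}) = x"
      using 1[OF x] by simp
  qed
  show "x \<in> {0..1} \<Longrightarrow> C x 1 = x" "y \<in> {0..1} \<Longrightarrow> C 1 y = y"
    using C top by simp_all
  have "measure M ({..0} \<times> {..y}) \<le> measure M ({..0} \<times> UNIV)" for y
    by (intro finite_measure_mono box) auto
  then show "y \<in> {0..1} \<Longrightarrow> C 0 y = 0"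
    using C[of 0 y] 1[of 0] measure_nonneg[of M "{..0} \<times> {..y}"] by (metis atLeastAtMost_iff order.antisym order.refl zero_le_one)
  have "measure M ({..x} \<times> {..0}) \<le> measure M (UNIV \<times> {..0})" for x
    by (intro finite_measure_mono box) auto
  then show "x \<in> {0..1} \<Longrightarrow> C x 0 = 0"
    using C[of x 0] 1[of 0] measure_nonneg[of M "{..x} \<times> {..0}"] by (metis atLeastAtMost_iff order.antisym order.refl zero_le_one)
qed

section \<open>The copula as the integral of its derivative in the first argument\<close>

context pickands
begin

text \<open>The copula in \<open>x\<close> with \<open>y\<close> fixed, the form to which the
  fundamental theorem is applied. For \<open>y\<close> in the open interval the expression gives the
  correct value \<open>y\<close> also at \<open>x = 1\<close>, where the angle is 0 and
  \<open>A\<close> is 1; the limit 0 at \<open>x = 0\<close> is put by hand.\<close>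

definition F :: "real \<Rightarrow> real \<Rightarrow> real" where
  "F y x = (if 0 < x then exp ((ln x + ln y) * A_ext (angle x y)) else 0)"

lemma F_eq_copula:
  assumes "copula C" "copula_of_pickands_function A C" and x: "x \<in> {0..1}" and y: "y \<in> {0<..<1}"
  shows "F y x = C x y"
proof -
  consider "x = 0" | "x = 1" | "x \<in> {0<..<1}"
    using x by force
  then show ?thesis
  proof cases
    case 1
    then show ?thesis
      using copula_margins(3)[OF assms(1), of y] y by (simp add: F_def)
  next
    case 2
    then show ?thesis
      using copula_margins(2)[OF assms(1), of y] y by (simp add: F_def angle_def A_ext_eq A_0)
  next
    case 3
    have "angle x y \<in> {0..1}"
      using angle_in[OF 3 y] by auto
    moreover have "ln (x * y) = ln x + ln y"
      using 3 y by (simp add: ln_mult)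
    moreover have "C x y = (x * y) powr A (ln x / ln (x * y))"
      using assms(2) 3 y unfolding copula_of_pickands_function_def by blast
    ultimately show ?thesis
      using 3 y by (simp add: F_def powr_def A_ext_eq angle_def mult.commute)
  qed
qed

text \<open>Follows from \<open>A t \<ge> t\<close>, as \<open>ln (x * y)\<close> times the angle is
  \<open>ln x\<close>; it squeezes \<open>F y\<close> at \<open>x = 0\<close>.\<close>

lemma F_le:
  assumes x: "x \<in> {0<..<1}" and y: "y \<in> {0<..<1}"
  shows "F y x \<le> x"
proof -
  have neg: "ln x + ln y < 0"
    using x y by (simp add: add_neg_neg)
  have a: "angle x y \<in> {0..1}"
    using angle_in[OF x y] by auto
  have "(ln x + ln y) * A_ext (angle x y) \<le> (ln x + ln y) * angle x y"
    using A_ge(2)[OF a] neg by (intro mult_left_mono_neg) (auto simp: A_ext_eq[OF a])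
  also have "\<dots> = ln x"
    using neg by (simp add: angle_def)
  finally have "exp ((ln x + ln y) * A_ext (angle x y)) \<le> exp (ln x)"
    by (simp only: exp_le_cancel_iff)
  also have "exp (ln x) = x"
    using x by simp
  finally show ?thesis
    using x by (simp add: F_def)
qed

lemma F_continuous:
  assumes y: "y \<in> {0<..<1}"
  shows "continuous_on {0..1} (F y)"
  unfolding continuous_on_def
proof
  fix x :: real assume x: "x \<in> {0..1}"
  show "(F y \<longlongrightarrow> F y x) (at x within {0..1})"
  proof (cases "x = 0")
    case False
    then have x0: "0 < x"
      using x by simp
    have nz: "ln x + ln y \<noteq> 0"
      using x x0 y by (smt (verit) greaterThanLessThan_iff atLeastAtMost_iff ln_less_zero ln_le_zero_iff)
    have "isCont (\<lambda>x. exp ((ln x + ln y) * A_ext (ln x / (ln x + ln y)))) x"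
      using x0 nz by (intro continuous_intros isCont_o2[OF _ A_ext_continuous]) auto
    moreover have "\<forall>\<^sub>F u in nhds x. u \<in> {0<..}"
      using x0 by (intro eventually_nhds_in_open) auto
    then have "\<forall>\<^sub>F u in nhds x. exp ((ln u + ln y) * A_ext (ln u / (ln u + ln y))) = F y u"
      by eventually_elim (simp add: F_def angle_def)
    ultimately have "isCont (F y) x"
      by (simp add: isCont_cong)
    then show ?thesis
      by (simp add: isCont_def tendsto_within_subset[of _ _ _ UNIV])
  next
    case True
    have "F y u \<le> u" if "u \<in> {0<..<1}" for u
      by (rule F_le[OF that y])
    moreover have "\<forall>\<^sub>F u in at_right 0. u \<in> {0<..<1::real}"
      by (rule eventually_at_right_real) simp
    ultimately have "\<forall>\<^sub>F u in at_right 0. F y u \<le> u"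
      by (auto elim: eventually_mono)
    moreover have "\<forall>\<^sub>F u in at_right 0. 0 \<le> F y u"
      by (simp add: F_def)
    ultimately have "(F y \<longlongrightarrow> 0) (at_right 0)"
      by (intro tendsto_sandwich[OF _ _ tendsto_const tendsto_ident_at])
    then show ?thesis
      using True by (simp add: F_def at_within_Icc_at_right)
  qed
qed

text \<open>The angle solved for \<open>x\<close> at fixed \<open>y\<close>. Hence the
  \<open>x\<close> whose angle is a jump of \<Theta> lie in an image of \<open>J\<close>, a
  countable set.\<close>

lemma angle_eq_iff:
  assumes "x \<in> {0<..<1}" "y \<in> {0<..<1}"
  shows "x = exp (ln y * angle x y / (1 - angle x y))"
proof -
  have "ln x < 0" "ln y < 0"
    using assms by auto
  then have nz: "ln x + ln y \<noteq> 0" "ln y \<noteq> 0"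
    by linarith+
  then have "1 - angle x y = ln y / (ln x + ln y)"
    by (simp add: angle_def diff_divide_eq_iff)
  then have "ln y * angle x y / (1 - angle x y) = ln x"
    using nz by (simp add: angle_def)
  then show ?thesis
    using assms by simp
qed

lemma h_angle:
  assumes x: "x \<in> {0<..<1}" and y: "y \<in> {0<..<1}"
  shows "h x (angle x y) = F y x / x"
proof -
  have "ln x < 0" "ln y < 0"
    using assms by auto
  then have nz: "ln x + ln y \<noteq> 0" "ln x \<noteq> 0"
    by linarith+
  then have "ln x * (A_ext (angle x y) / angle x y - 1) = (ln x + ln y) * A_ext (angle x y) - ln x"
    by (simp add: angle_def right_diff_distrib)
  then show ?thesis
    using x angle_in[OF x y] by (simp add: h_def F_def exp_diff)
qed

lemma nn_integral_F:
  assumes x: "x \<in> {0<..1}" and y: "y \<in> {0<..<1}"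
  shows "(\<integral>\<^sup>+u\<in>{0<..<x}. ennreal (h u (angle u y) * G (angle u y)) \<partial>lborel) = ennreal (F y x)"
proof -
  define S where "S = (\<lambda>t. exp (ln y * t / (1 - t))) ` J"
  have "(\<integral>\<^sup>+u\<in>{0<..<x}. ennreal (h u (angle u y) * G (angle u y)) \<partial>lborel) = ennreal (F y x - F y 0)"
  proof (rule nn_integral_FTC_off_countable[where S = S])
    show "0 < x"
      using x by simp
    show "continuous_on {0..x} (F y)"
      by (rule continuous_on_subset[OF F_continuous[OF y]]) (use x in auto)
    show "countable S"
      by (simp add: S_def countable_J)
    have [measurable]: "(\<lambda>u. h u (angle u y)) \<in> borel_measurable borel"
    proof -
      have "(\<lambda>u. (u, angle u y)) \<in> borel \<rightarrow>\<^sub>M borel \<Otimes>\<^sub>M borel"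
        by measurable
      from measurable_compose[OF this h_measurable] show ?thesis
        by simp
    qed
    show "(\<lambda>u. h u (angle u y) * G (angle u y)) \<in> borel_measurable borel"
      by measurable
    show "0 \<le> h u (angle u y) * G (angle u y)" if "u \<in> {0<..<x}" for u
      using angle_in[of u y] that x y by (intro mult_nonneg_nonneg h_nonneg G_nonneg) auto
    show "\<exists>B. \<forall>u\<in>{c..d}. h u (angle u y) * G (angle u y) \<le> B" if "0 < c" "d < x" for c d
    proof (intro exI ballI)
      fix u assume "u \<in> {c..d}"
      then have u: "u \<in> {0<..<1}"
        using that x by auto
      then have a: "angle u y \<in> {0..1}"
        using angle_in[OF u y] by auto
      show "h u (angle u y) * G (angle u y) \<le> 1 * 2"
        by (intro mult_mono h_le_1[OF u a] G_le[OF a] G_nonneg[OF a]) simp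
    qed
    fix u assume "u \<in> {0<..<x} - S"
    then have u: "u \<in> {0<..<1}" and uS: "u \<notin> S"
      using x by auto
    define t where "t = angle u y"
    have t: "t \<in> {0<..<1}"
      unfolding t_def by (rule angle_in[OF u y])
    have tJ: "t \<notin> J"
      using uS angle_eq_iff[OF u y] by (auto simp: S_def t_def)
    have "ln u < 0" "ln y < 0"
      using u y by auto
    then have nz: "ln u + ln y \<noteq> 0" "ln u \<noteq> 0"
      by linarith+
    have near: "\<forall>\<^sub>F s in nhds u. s \<in> {0<..<1}"
      using u by (intro eventually_nhds_in_open) auto
    have dangle: "((\<lambda>u. ln u / (ln u + ln y)) has_real_derivative ln y / (u * (ln u + ln y)\<^sup>2)) (at u)"
      using u nz by (auto intro!: derivative_eq_intros simp: field_simps power2_eq_square)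
    have "(A has_real_derivative (2 * \<Theta> t - 1)) (at (ln u / (ln u + ln y)))"
      using A_deriv[OF t tJ] by (simp add: t_def angle_def)
    from DERIV_chain2[OF this dangle]
    have dA: "((\<lambda>u. A (ln u / (ln u + ln y))) has_real_derivative (2 * \<Theta> t - 1) * (ln y / (u * (ln u + ln y)\<^sup>2))) (at u)" .
    have At: "A (ln u / (ln u + ln y)) = A_ext t"
      using t A_ext_eq[of t] by (simp add: t_def angle_def)
    have "((\<lambda>u. exp ((ln u + ln y) * A (ln u / (ln u + ln y)))) has_real_derivative
        exp ((ln u + ln y) * A_ext t) * (1 / u * A_ext t + (ln u + ln y) * ((2 * \<Theta> t - 1) * (ln y / (u * (ln u + ln y)\<^sup>2))))) (at u)"
      using u by (auto intro!: derivative_eq_intros dA simp: At)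
    \<comment> \<open>The logarithms collapse because \<open>ln y / (ln u + ln y)\<close> is
      \<open>1 - t\<close>; this is the origin of the combination of \<open>A\<close> and its
      derivative in \<open>G\<close>.\<close>
    also have "1 / u * A_ext t + (ln u + ln y) * ((2 * \<Theta> t - 1) * (ln y / (u * (ln u + ln y)\<^sup>2))) = G t / u"
    proof -
      have "1 - t = ln y / (ln u + ln y)"
        using nz by (simp add: t_def angle_def diff_divide_eq_iff)
      then show ?thesis
        using nz by (simp add: G_def power2_eq_square add_divide_distrib mult.commute)
    qed
    finally have D: "((\<lambda>u. exp ((ln u + ln y) * A (ln u / (ln u + ln y)))) has_real_derivative
        exp ((ln u + ln y) * A_ext t) * (G t / u)) (at u)" .
    show "(F y has_real_derivative h u (angle u y) * G (angle u y)) (at u)"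
    proof (rule has_field_derivative_transform_within_open[where S = "{0<..<1}"])
      show "((\<lambda>u. exp ((ln u + ln y) * A (ln u / (ln u + ln y)))) has_real_derivative
          h u (angle u y) * G (angle u y)) (at u)"
        using D u by (simp add: h_angle[OF u y] F_def t_def)
      fix s :: real assume s: "s \<in> {0<..<1}"
      have "angle s y \<in> {0..1}"
        using angle_in[OF s y] by auto
      then show "exp ((ln s + ln y) * A (ln s / (ln s + ln y))) = F y s"
        using s A_ext_eq[of "angle s y"] by (simp add: F_def angle_def)
    qed (use u in auto)
    have ca: "isCont (\<lambda>u. angle u y) u"
      unfolding angle_def using u nz by (intro continuous_intros) auto
    have cA: "isCont (\<lambda>u. A_ext (angle u y)) u"
      by (rule isCont_o2[OF ca A_ext_continuous])
    have "isCont \<Theta> (angle u y)"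
      using tJ by (simp add: J_def t_def)
    with ca have c\<Theta>: "isCont (\<lambda>u. \<Theta> (angle u y)) u"
      by (rule isCont_o2)
    have cF: "isCont (F y) u"
      using u continuous_on_interior[OF F_continuous[OF y], of u] by simp
    have "isCont (\<lambda>u. F y u / u * (A_ext (angle u y) + (1 - angle u y) * (2 * \<Theta> (angle u y) - 1))) u"
      using u by (intro isCont_mult isCont_divide isCont_add isCont_diff continuous_const continuous_ident ca cA c\<Theta> cF) auto
    moreover have "\<forall>\<^sub>F s in nhds u. F y s / s * (A_ext (angle s y) + (1 - angle s y) * (2 * \<Theta> (angle s y) - 1)) =
        h s (angle s y) * G (angle s y)"
      using near by eventually_elim (simp add: h_angle[OF _ y] G_def)
    ultimately show "isCont (\<lambda>u. h u (angle u y) * G (angle u y)) u"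
      by (simp add: isCont_cong)
  qed
  then show ?thesis
    by (simp add: F_def)
qed

text \<open>By \<open>K_atMost\<close> the mass of \<open>{0..y}\<close> is the derivative of
  \<open>C\<close> in its first argument, which \<open>nn_integral_F\<close> integrates back; the
  edges 0 and 1 come from \<open>copula_margins\<close>. Rectangles anchored at the origin determine
  the joint law.\<close>

lemma markov_kernel_of_K:
  assumes C: "copula C" "copula_of_pickands_function A C"
  shows "markov_kernel_of C K"
proof -
  have "copula_measure C = kernel_measure K"
  proof (rule copula_measure_eqI)
    show "sets (kernel_measure K) = sets (unit_leb \<Otimes>\<^sub>M unit_leb)"
      by (rule sets_kernel_measure[OF K_measurable])
    fix x y :: real assume x: "x \<in> {0..1}" and y: "y \<in> {0..1}"
    have "emeasure (kernel_measure K) ({0..x} \<times> {0..y}) = (\<integral>\<^sup>+u\<in>{0..x}. emeasure (K u) {0..y} \<partial>unit_leb)"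
      by (rule emeasure_kernel_measure_times[OF K_measurable]) (use x y in \<open>auto simp: sets_unit_leb_iff\<close>)
    also have "\<dots> = ennreal (C x y)"
    proof -
      consider "y = 0" | "y = 1" | "x = 0" | "x \<in> {0<..1}" "y \<in> {0<..<1}"
        using x y by force
      then show ?thesis
      proof cases
        case 1
        have "(\<integral>\<^sup>+u\<in>{0..x}. emeasure (K u) {0..y} \<partial>unit_leb) = (\<integral>\<^sup>+u. 0 \<partial>unit_leb)"
          by (intro nn_integral_cong_AE)
             (use AE_unit_leb_interior in eventually_elim, use K_0 1 in simp)
        then show ?thesis
          using copula_margins(4)[OF C(1) x] 1 by simp
      next
        case 2
        have "(\<integral>\<^sup>+u\<in>{0..x}. emeasure (K u) {0..y} \<partial>unit_leb) = emeasure unit_leb {0..x}"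
          using x by (simp add: 2 K_1 sets_unit_leb_iff)
        also have "\<dots> = ennreal x"
          using x by (simp add: emeasure_restrict_space)
        finally show ?thesis
          using copula_margins(1)[OF C(1) x] 2 by simp
      next
        case 3
        have "(\<integral>\<^sup>+u\<in>{0..x}. emeasure (K u) {0..y} \<partial>unit_leb) = (\<integral>\<^sup>+u. 0 \<partial>unit_leb)"
          by (intro nn_integral_cong_AE)
             (use AE_unit_leb_interior in eventually_elim, use 3 in \<open>simp add: indicator_def\<close>)
        then show ?thesis
          using copula_margins(3)[OF C(1) y] 3 by simp
      next
        case 4
        let ?f = "\<lambda>u. ennreal (h u (angle u y) * G (angle u y))"
        have "(\<integral>\<^sup>+u\<in>{0..x}. emeasure (K u) {0..y} \<partial>unit_leb) = (\<integral>\<^sup>+u\<in>{0..x}. ?f u \<partial>unit_leb)"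
          by (intro nn_integral_cong_AE)
             (use AE_unit_leb_interior in eventually_elim, use K_atMost 4 in simp)
        also have "\<dots> = (\<integral>\<^sup>+u. ?f u * indicator {0..x} u * indicator {0..1} u \<partial>lborel)"
          by (rule nn_integral_restrict_space) simp
        also have "\<dots> = (\<integral>\<^sup>+u\<in>{0<..<x}. ?f u \<partial>lborel)"
        proof (rule nn_integral_cong_AE)
          show "AE u in lborel. ?f u * indicator {0..x} u * indicator {0..1} u = ?f u * indicator {0<..<x} u"
            using AE_lborel_singleton[of 0] AE_lborel_singleton[of x]
            by eventually_elim (use x in \<open>auto simp: indicator_def\<close>)
        qed
        also have "\<dots> = ennreal (C x y)"
          using nn_integral_F[OF 4] F_eq_copula[OF C x 4(2)] by simp
        finally show ?thesis .
      qed
    qed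
    finally show "emeasure (kernel_measure K) ({0..x} \<times> {0..y}) = ennreal (C x y)" .
  qed
  then show ?thesis
    using K_measurable emeasure_kernel_measure_times[OF K_measurable]
    by (simp add: markov_kernel_of_def)
qed

section \<open>Comparison of the components of \<theta> and of the copula\<close>

lemma absolutely_continuous_interior_iff:
  assumes N: "N \<in> null_sets lborel" "N \<subseteq> {0<..<1}"
    and null: "\<And>E. E \<in> null_sets lborel \<Longrightarrow> E \<subseteq> {0<..<1} - N \<Longrightarrow> emeasure \<tau> E = 0"
  shows "absolutely_continuous (restrict_space lborel {0<..<1}) (restrict_space \<theta> {0<..<1}) \<longleftrightarrow> emeasure \<tau> N = 0"
proof -
  have m: "{0<..<1::real} \<in> sets \<theta>"
    by (auto simp: sets_\<theta> sets_unit_leb_iff)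
  have \<tau>\<theta>: "emeasure \<tau> E = emeasure \<theta> E" if "E \<in> sets borel" "E \<subseteq> {0<..<1}" for E
  proof -
    have "E \<inter> {0..1} = E"
      using that by auto
    then show ?thesis
      using emeasure_\<tau>[OF that(1)] by simp
  qed
  have nl: "E \<in> null_sets (restrict_space lborel {0<..<1}) \<longleftrightarrow> E \<subseteq> {0<..<1} \<and> E \<in> null_sets lborel" for E :: "real set"
    by (rule null_sets_restrict_space) simp
  have nt: "E \<in> null_sets (restrict_space \<theta> {0<..<1}) \<longleftrightarrow> emeasure \<tau> E = 0" if "E \<subseteq> {0<..<1}" "E \<in> null_sets lborel" for E
  proof -
    have "E \<in> sets \<theta>"
      using that by (auto simp: sets_\<theta> sets_unit_leb_iff)
    then show ?thesis
      using that \<tau>\<theta>[of E] null_sets_restrict_space[OF m, of E] by (auto simp: null_sets_def)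
  qed
  \<comment> \<open>\<open>N\<close> carries all the mass that \<tau> puts on null sets of the open
    interval, so its own mass decides absolute continuity.\<close>
  have "emeasure \<tau> E = 0" if "emeasure \<tau> N = 0" "E \<subseteq> {0<..<1}" "E \<in> null_sets lborel" for E
  proof -
    have "emeasure \<tau> E = emeasure \<tau> (E \<inter> N) + emeasure \<tau> (E - N)"
      using that N by (intro emeasure_Int_add_Diff) auto
    moreover have "emeasure \<tau> (E \<inter> N) \<le> emeasure \<tau> N"
      using that N by (intro emeasure_mono) auto
    moreover have "emeasure \<tau> (E - N) = 0"
      using that N by (intro null null_set_Diff) auto
    ultimately show ?thesis
      using that(1) by simp
  qed
  note * = this
  show ?thesis
    unfolding absolutely_continuous_def
  proof
    assume "null_sets (restrict_space lborel {0<..<1}) \<subseteq> null_sets (restrict_space \<theta> {0<..<1})"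
    then show "emeasure \<tau> N = 0"
      using nl[of N] nt[of N] N by blast
  next
    assume "emeasure \<tau> N = 0"
    then show "null_sets (restrict_space lborel {0<..<1}) \<subseteq> null_sets (restrict_space \<theta> {0<..<1})"
      using nl nt * by blast
  qed
qed

theorem component_equivalences:
  assumes C: "copula C" "copula_of_pickands_function A C"
  shows "absolutely_continuous (restrict_space lborel {0<..<1}) (restrict_space \<theta> {0<..<1})
      \<longleftrightarrow> absolutely_continuous_copula C"
    and "(\<exists>t\<in>{0<..<1}. emeasure \<theta> {t} > 0)
      \<longleftrightarrow> emeasure (copula_component dis_part C) ({0..1} \<times> {0..1}) > 0"
    and "emeasure (sing_part \<theta>) {0..1} > 0
      \<longleftrightarrow> emeasure (copula_component sing_part C) ({0..1} \<times> {0..1}) > 0"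
proof -
  obtain D0 N0 where 0: "countable D0" "D0 \<subseteq> N0" "N0 \<in> null_sets unit_leb"
    "\<And>t. t \<in> {0..1} \<Longrightarrow> t \<in> D0 \<longleftrightarrow> emeasure \<theta> {t} > 0"
    "\<And>E. E \<in> null_sets unit_leb \<Longrightarrow> emeasure \<theta> (E - N0) = 0"
    using finite_measure_lebesgue_sets[OF \<theta>.finite_measure_axioms sets_\<theta>] by metis
  \<comment> \<open>End points are removed because the kernel does not see them, while \<theta> may
    have atoms there.\<close>
  define D where "D = D0 \<inter> {0<..<1}"
  define N where "N = N0 \<inter> {0<..<1}"
  have D: "countable D" "D \<subseteq> N" "D \<subseteq> {0<..<1}"
    using 0 by (auto simp: D_def N_def)
  have N: "N \<in> null_sets lborel" "N \<subseteq> {0<..<1}"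
    using 0 by (auto simp: N_def null_sets_unit_leb_iff intro: null_set_Int2)
  have Dnull: "D \<in> null_sets lborel"
    by (rule countable_imp_null_set_lborel[OF D(1)])
  have m [measurable]: "D \<in> sets borel" "N \<in> sets borel"
    using Dnull N by auto
  have \<tau>\<theta>: "emeasure \<tau> E = emeasure \<theta> E" if "E \<in> sets borel" "E \<subseteq> {0..1}" for E
    using emeasure_\<tau>[OF that(1)] that(2) by (simp add: Int_absorb2)
  have atoms: "emeasure \<tau> {t} = 0" if "t \<in> {0<..<1} - D" for t
    using 0(4)[of t] that \<tau>\<theta>[of "{t}"] by (auto simp: D_def zero_less_iff_neq_zero)
  have null: "emeasure \<tau> E = 0" if "E \<in> null_sets lborel" "E \<subseteq> {0<..<1} - N" for E
  proof -
    have "E - N0 = E"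
      using that by (auto simp: N_def)
    moreover have "E \<in> null_sets unit_leb"
      using that by (auto simp: null_sets_unit_leb_iff)
    ultimately have "emeasure \<theta> E = 0"
      using 0(5)[of E] by simp
    moreover have "E \<subseteq> {0..1}"
      using that by auto
    ultimately show ?thesis
      using \<tau>\<theta>[of E] that by auto
  qed
  note CK = markov_kernel_of_K[OF C]
  have top: "{0..1} \<times> {0..1} \<in> sets (unit_leb \<Otimes>\<^sub>M unit_leb)"
    by (intro pair_measureI) (simp_all add: sets_unit_leb_iff)
  \<comment> \<open>Each part of the kernel is a restriction to the section of one set in the
    square, as required by \<open>copula_component_restrict\<close>.\<close>
  have parts: "AE x in unit_leb. abs_part (K x) = density (K x) (indicator (Pair x -` ({0..1} \<times> {0..1} - sector N)))"
    "AE x in unit_leb. dis_part (K x) = density (K x) (indicator (Pair x -` sector D))"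
    "AE x in unit_leb. sing_part (K x) = density (K x) (indicator (Pair x -` sector (N - D)))"
  proof -
    have "{0..1} - Pair x -` sector N = Pair x -` ({0..1} \<times> {0..1} - sector N)"
      "Pair x -` sector N - Pair x -` sector D = Pair x -` sector (N - D)" if "x \<in> {0<..<1}" for x
      using that by (auto simp: sector_def)
    note eqs = this
    show "AE x in unit_leb. abs_part (K x) = density (K x) (indicator (Pair x -` ({0..1} \<times> {0..1} - sector N)))"
      using AE_unit_leb_interior
      by eventually_elim (simp only: K_parts(1)[OF _ D(1,2) N atoms null] eqs(1))
    show "AE x in unit_leb. dis_part (K x) = density (K x) (indicator (Pair x -` sector D))"
      using AE_unit_leb_interior
      by eventually_elim (simp only: K_parts(2)[OF _ D(1,2) N atoms null])
    show "AE x in unit_leb. sing_part (K x) = density (K x) (indicator (Pair x -` sector (N - D)))"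
      using AE_unit_leb_interior
      by eventually_elim (simp only: K_parts(3)[OF _ D(1,2) N atoms null] eqs(2))
  qed
  note restrict = copula_component_restrict[OF K_measurable CK]
  have "N - D \<in> null_sets lborel" "N - D \<subseteq> {0<..<1}" "N - D \<in> sets borel"
    using N m by (auto intro: null_set_Diff)
  note ND = this

  show "(\<exists>t\<in>{0<..<1}. emeasure \<theta> {t} > 0)
      \<longleftrightarrow> emeasure (copula_component dis_part C) ({0..1} \<times> {0..1}) > 0"
  proof -
    \<comment> \<open>\<open>D\<close> collects exactly the atoms in the open interval, so its mass
      is positive as soon as it is nonempty.\<close>
    have "emeasure \<tau> D > 0 \<longleftrightarrow> D \<noteq> {}"
    proof
      assume "D \<noteq> {}"
      then obtain t where t: "t \<in> D"
        by auto
      then have "0 < emeasure \<theta> {t}"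
        using 0(4)[of t] D by (auto simp: D_def)
      also have "emeasure \<theta> {t} = emeasure \<tau> {t}"
        using t D by (intro \<tau>\<theta>[symmetric]) auto
      also have "\<dots> \<le> emeasure \<tau> D"
        using t by (intro emeasure_mono) auto
      finally show "emeasure \<tau> D > 0" .
    qed auto
    also have "\<dots> \<longleftrightarrow> (\<exists>t\<in>{0<..<1}. emeasure \<theta> {t} > 0)"
    proof -
      have "t \<in> D \<longleftrightarrow> emeasure \<theta> {t} > 0" if "t \<in> {0<..<1}" for t
        using 0(4)[of t] that by (simp add: D_def)
      then show ?thesis
        using D(3) by blast
    qed
    finally show ?thesis
      unfolding restrict[OF sector_sets[OF m(1)] parts(2)] K_sector_mass_pos_iff[OF Dnull D(3)] ..
  qed

  show "emeasure (sing_part \<theta>) {0..1} > 0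
      \<longleftrightarrow> emeasure (copula_component sing_part C) ({0..1} \<times> {0..1}) > 0"
  proof -
    have sing: "sing_part \<theta> = density \<theta> (indicator (N0 - D0))"
      by (rule lebesgue_decomposition_densityI(3)[OF sets_\<theta> 0(1-3)]) (use 0(4,5) in auto)
    have N0: "N0 \<subseteq> {0..1}" "N0 \<in> sets borel"
      using 0(3) by (auto simp: null_sets_unit_leb_iff)
    have "D0 \<in> sets unit_leb"
      using 0(1,2) N0 by (intro countable_sets_unit_leb) auto
    then have ND0: "N0 - D0 \<in> sets borel"
      using N0 by (auto simp: sets_unit_leb_iff)
    have "emeasure (sing_part \<theta>) {0..1} = emeasure \<theta> ((N0 - D0) \<inter> {0..1})"
      unfolding sing using ND0 N0 by (intro emeasure_restricted) (auto simp: sets_\<theta> sets_unit_leb_iff)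
    also have "\<dots> = emeasure \<tau> (N0 - D0)"
      using emeasure_\<tau>[OF ND0] by simp
    \<comment> \<open>The two sets differ at most by end points outside \<open>D0\<close>, which
      carry no mass; so the singular statement holds without restriction to the open
      interval.\<close>
    also have "\<dots> = emeasure \<tau> (N - D)"
    proof (rule emeasure_eq_AE)
      have "emeasure \<tau> {t} = 0" if "t \<in> {0..1} - D0" for t
        using 0(4)[of t] that \<tau>\<theta>[of "{t}"] by (auto simp: zero_less_iff_neq_zero)
      then have "AE s in \<tau>. s \<notin> {0} - D0" "AE s in \<tau>. s \<notin> {1} - D0"
        by (intro AE_not_in null_setsI; auto simp: insert_Diff_if)+
      then show "AE s in \<tau>. s \<in> N0 - D0 \<longleftrightarrow> s \<in> N - D"
      proof eventually_elim
        case (elim s)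
        have "s = 0 \<or> s = 1" if "s \<in> N0" "s \<notin> {0<..<1}"
          using subsetD[OF N0(1) that(1)] that(2) by auto
        then show ?case
          using elim by (cases "s \<in> {0<..<1}") (auto simp: N_def D_def)
      qed
    qed (use ND0 ND in auto)
    finally show ?thesis
      unfolding restrict[OF sector_sets[OF ND(3)] parts(3)] K_sector_mass_pos_iff[OF ND(1,2)] by simp
  qed

  show "absolutely_continuous (restrict_space lborel {0<..<1}) (restrict_space \<theta> {0<..<1})
      \<longleftrightarrow> absolutely_continuous_copula C"
  proof -
    let ?\<nu> = "kernel_measure K"
    have cancel: "b = 1 \<longleftrightarrow> a = 0" if "1 = a + b" for a b :: ennreal
    proof
      assume "b = 1"
      with that have "1 + a = 1 + 0"
        by (simp add: add.commute)
      then show "a = 0"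
        using ennreal_add_left_cancel[of 1 a 0] by simp
    qed (use that in simp)
    have sec: "sector N \<in> sets (unit_leb \<Otimes>\<^sub>M unit_leb)" "sector N \<inter> {0..1} \<times> {0..1} = sector N"
      using sector_sets[OF m(2)] by (auto simp: sector_def)
    have ms: "sector N \<in> sets ?\<nu>" "{0..1} \<times> {0..1} \<in> sets ?\<nu>"
      using sec top by (simp_all add: sets_kernel_measure[OF K_measurable])
    have total: "emeasure ?\<nu> ({0..1} \<times> {0..1}) = 1"
    proof -
      have "emeasure ?\<nu> ({0..1} \<times> {0..1}) = (\<integral>\<^sup>+x\<in>{0..1}. emeasure (K x) {0..1} \<partial>unit_leb)"
        by (rule emeasure_kernel_measure_times[OF K_measurable]) (simp_all add: sets_unit_leb_iff)
      also have "\<dots> = emeasure unit_leb {0..1}"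
        by (simp add: K_1 sets_unit_leb_iff)
      finally show ?thesis
        by (simp add: emeasure_restrict_space)
    qed
    \<comment> \<open>The joint law has mass 1 and the absolutely continuous component is its part
      off \<open>sector N\<close>, so full mass of the component means that \<open>sector N\<close>
      has none.\<close>
    have "emeasure (copula_component abs_part C) ({0..1} \<times> {0..1}) = emeasure ?\<nu> ({0..1} \<times> {0..1} - sector N)"
      unfolding restrict[OF sets.Diff[OF top sec(1)] parts(1)]
      by (rule emeasure_kernel_measure[OF K_measurable sets.Diff[OF top sec(1)], symmetric])
    moreover have "1 = emeasure ?\<nu> (sector N) + emeasure ?\<nu> ({0..1} \<times> {0..1} - sector N)"
      using emeasure_Int_add_Diff[OF ms(2,1)] sec(2) total by (simp add: Int_commute)
    ultimately have "absolutely_continuous_copula C \<longleftrightarrow> emeasure ?\<nu> (sector N) = 0"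
      unfolding absolutely_continuous_copula_def by (simp only: cancel)
    also have "\<dots> \<longleftrightarrow> emeasure \<tau> N = 0"
      using K_sector_mass_pos_iff[OF N] emeasure_kernel_measure[OF K_measurable sec(1)]
      by (simp add: zero_less_iff_neq_zero)
    finally show ?thesis
      using absolutely_continuous_interior_iff[OF N null] by simp
  qed
qed

end

theorem theorem4p6:
  fixes C :: "real \<Rightarrow> real \<Rightarrow> real" and \<theta> :: "real measure" and A :: "real \<Rightarrow> real"
  assumes "extreme_value_copula C"
    and "pickands_measure \<theta>"
    and "pickands_function A"
    and "pickands_function_of_measure \<theta> A"
    and "copula_of_pickands_function A C"
  shows "(absolutely_continuous (restrict_space lborel {0<..<1}) (restrict_space \<theta> {0<..<1})
            \<longleftrightarrow> absolutely_continuous_copula C)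
       \<and> ((\<exists>t\<in>{0<..<1}. emeasure \<theta> {t} > 0)
            \<longleftrightarrow> emeasure (copula_component dis_part C) ({0..1} \<times> {0..1}) > 0)
       \<and> (emeasure (sing_part \<theta>) {0..1} > 0
            \<longleftrightarrow> emeasure (copula_component sing_part C) ({0..1} \<times> {0..1}) > 0)"
proof -
  interpret pickands \<theta> A
    by standard fact+
  have "copula C"
    using assms(1) by (simp add: extreme_value_copula_def)
  from component_equivalences[OF this assms(5)] show ?thesis
    by blast
qed

end
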